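(* Let $H$ and $K$ be nonzero complex Hilbert spaces, let $n$ be a positive integer, and let $T_1\in B(H)$ and $T_2\in B(K)$. Then the following are equivalent: (a) $T_1\otimes I_K+I_H\otimes T_2$ is an $n$-symmetry in $B(H\overline\otimes K)$. (b) There exist positive integers $l,m$ with $l+m=n+1$ and $\lambda\in\mathbb{C}$ such that $T_1+\lambda I_H$ is an $l$-symmetry in $B(H)$ and $T_2-\lambda I_K$ is an $m$-symmetry in $B(K)$.
   Context: $B(H)$ is the algebra of bounded linear operators on $H$, $I_H$ is the identity operator on $H$, and $H\overline\otimes K$ is the Hilbert space tensor product. For $S,T$ in a unital $\mathbb{C}$-algebra define $\gamma_n(S,T)=\sum_{k=0}^n(-1)^{n-k}\binom{n}{k}S^kT^{n-k}$. An operator $T$ on a Hilbert space is an $n$-symmetry if $\gamma_n(T^\ast,T)=0$. *)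

theory Defs
  imports "HOL-Analysis.Analysis"
begin

section \<open>Complex Hilbert spaces\<close>

class complex_vector = real_vector +
  fixes scaleC :: "complex \<Rightarrow> 'a \<Rightarrow> 'a"
  assumes scaleC_add_right: "scaleC a (x + y) = scaleC a x + scaleC a y"
    and scaleC_add_left: "scaleC (a + b) x = scaleC a x + scaleC b x"
    and scaleC_scaleC [simp]: "scaleC a (scaleC b x) = scaleC (a * b) x"
    and scaleR_scaleC: "scaleR r x = scaleC (complex_of_real r) x"
begin

lemma scaleC_one [simp]: "scaleC 1 x = x"
  using scaleR_scaleC[of 1 x] by (simp add: scaleR_one)

lemma scaleC_zero_right [simp]: "scaleC a 0 = 0"
  using scaleC_add_right[of a 0 0] by simp

lemma scaleC_zero_left [simp]: "scaleC 0 x = 0"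
  using scaleC_add_left[of 0 0 x] by simp

lemma scaleC_minus_right: "scaleC a (- x) = - scaleC a x"
  using scaleC_add_right[of a x "- x"] by (simp add: eq_neg_iff_add_eq_0 add.commute)

lemma scaleC_minus_left: "scaleC (- a) x = - scaleC a x"
  using scaleC_add_left[of a "- a" x] by (simp add: eq_neg_iff_add_eq_0 add.commute)

lemma scaleC_diff_right: "scaleC a (x - y) = scaleC a x - scaleC a y"
  using scaleC_add_right[of a x "- y"] by (simp add: scaleC_minus_right)

lemma scaleC_sum_right: "scaleC a (\<Sum>i\<in>A. f i) = (\<Sum>i\<in>A. scaleC a (f i))"
  by (induction A rule: infinite_finite_induct) (simp_all add: scaleC_add_right)

end

text \<open>
  A complex inner product space carries the underlying real inner product space
  (with \<open>inner = Re cinner\<close>) along with it, so positive definiteness of \<^const>\<open>inner\<close>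
  is positive definiteness of \<open>cinner\<close>, and norm, topology and completeness are those of the
  library. The form \<open>cinner\<close> is linear in its second argument.
\<close>

class complex_inner = real_inner + complex_vector +
  fixes cinner :: "'a \<Rightarrow> 'a \<Rightarrow> complex"
  assumes cinner_commute: "cinner x y = cnj (cinner y x)"
    and cinner_add_right: "cinner x (y + z) = cinner x y + cinner x z"
    and cinner_scaleC_right [simp]: "cinner x (scaleC c y) = c * cinner x y"
    and inner_eq_Re_cinner: "inner x y = Re (cinner x y)"

lemma cinner_add_left: "cinner (x + y) z = cinner x z + cinner y z"
  by (subst (1 2 3) cinner_commute) (simp add: cinner_add_right)

lemma cinner_scaleC_left [simp]: "cinner (scaleC c x) y = cnj c * cinner x y"
  by (subst (1 2) cinner_commute) simp

lemma cinner_zero_right [simp]: "cinner x 0 = 0"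
  using cinner_add_right[of x 0 0] by simp

lemma cinner_zero_left [simp]: "cinner 0 x = 0"
  by (subst cinner_commute) simp

lemma cinner_minus_right [simp]: "cinner x (- y) = - cinner x y"
  using cinner_add_right[of x y "- y"] by (simp add: eq_neg_iff_add_eq_0 add.commute)

lemma cinner_minus_left [simp]: "cinner (- x) y = - cinner x y"
  by (subst (1 2) cinner_commute) simp

lemma cinner_diff_right: "cinner x (y - z) = cinner x y - cinner x z"
  using cinner_add_right[of x y "- z"] by simp

lemma cinner_diff_left: "cinner (x - y) z = cinner x z - cinner y z"
  using cinner_add_left[of x "- y" z] by simp

lemma cinner_sum_right: "cinner x (\<Sum>i\<in>A. f i) = (\<Sum>i\<in>A. cinner x (f i))"
  by (induction A rule: infinite_finite_induct) (simp_all add: cinner_add_right)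

lemma cinner_sum_left: "cinner (\<Sum>i\<in>A. f i) x = (\<Sum>i\<in>A. cinner (f i) x)"
  by (induction A rule: infinite_finite_induct) (simp_all add: cinner_add_left)

lemma cinner_self: "cinner x x = complex_of_real ((norm x)\<^sup>2)"
proof -
  have "Im (cinner x x) = 0"
    using arg_cong[OF cinner_commute[of x x], of Im] by simp
  then show ?thesis
    by (simp add: complex_eq_iff power2_norm_eq_inner inner_eq_Re_cinner)
qed

lemma cinner_eq_zero_iff [simp]: "cinner x x = 0 \<longleftrightarrow> x = 0"
  by (metis cinner_self inner_eq_zero_iff power2_norm_eq_inner of_real_eq_0_iff)

lemma cinner_ext: "(\<And>z. cinner z x = cinner z y) \<Longrightarrow> x = y"
  by (metis cinner_diff_right cinner_eq_zero_iff right_minus_eq)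

lemma cinner_ext_left: "(\<And>z. cinner x z = cinner y z) \<Longrightarrow> x = y"
  by (metis cinner_diff_left cinner_eq_zero_iff right_minus_eq)

lemma Im_cinner: "Im (cinner x y) = inner (scaleC \<i> x) y"
  by (simp add: inner_eq_Re_cinner)

lemma norm_scaleC [simp]: "norm (scaleC c x) = cmod c * norm (x :: 'a::complex_inner)"
proof -
  have "complex_of_real ((norm (scaleC c x))\<^sup>2) = cinner (scaleC c x) (scaleC c x)"
    by (rule cinner_self[symmetric])
  also have "\<dots> = (c * cnj c) * cinner x x"
    by (simp only: cinner_scaleC_left cinner_scaleC_right ac_simps)
  also have "\<dots> = complex_of_real ((cmod c * norm x)\<^sup>2)"
    unfolding cinner_self complex_norm_square[symmetric] by (simp add: power_mult_distrib)
  finally have "(norm (scaleC c x))\<^sup>2 = (cmod c * norm x)\<^sup>2"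
    by (simp only: of_real_eq_iff)
  then show ?thesis by (simp add: power2_eq_iff_nonneg)
qed

lemma cinner_bound: "cmod (cinner x y) \<le> norm x * norm (y :: 'a::complex_inner)"
proof (cases "cinner x y = 0")
  case False
  define c where "c = cnj (sgn (cinner x y))"
  have c: "cmod c = 1" using False by (simp add: c_def norm_sgn)
  have "c * cinner x y = complex_of_real (cmod (cinner x y))"
    using False complex_norm_square[of "cinner x y"]
    by (simp add: c_def sgn_eq divide_simps mult.commute power2_eq_square)
  then have "cmod (cinner x y) = inner x (scaleC c y)"
    by (simp add: inner_eq_Re_cinner)
  also have "\<dots> \<le> norm x * norm (scaleC c y)"
    using Cauchy_Schwarz_ineq2[of x "scaleC c y"] by simp
  finally show ?thesis using c by simp
qed simp

lemma scaleR_cinner_right [simp]: "cinner x (scaleR r y) = of_real r * cinner x (y::'a::complex_inner)"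
  by (simp add: scaleR_scaleC)

lemma scaleR_cinner_left [simp]: "cinner (scaleR r x) y = of_real r * cinner x (y::'a::complex_inner)"
  by (simp add: scaleR_scaleC)

lemma bounded_bilinear_cinner:
  "bounded_bilinear (cinner :: 'a::complex_inner \<Rightarrow> 'a \<Rightarrow> complex)"
  by unfold_locales
     (auto simp: cinner_add_left cinner_add_right scaleR_conv_of_real intro!: exI[of _ 1] cinner_bound)

lemmas tendsto_cinner [tendsto_intros] = bounded_bilinear.tendsto[OF bounded_bilinear_cinner]

lemma bounded_linear_scaleC: "bounded_linear (scaleC c :: 'a::complex_inner \<Rightarrow> 'a)"
  by (rule bounded_linear_intro[where K = "cmod c"])
     (simp_all add: scaleC_add_right scaleR_scaleC mult.commute)

lemmas tendsto_scaleC [tendsto_intros] = bounded_linear.tendsto[OF bounded_linear_scaleC]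

class chilbert_space = complex_inner + complete_space

section \<open>The algebra of bounded operators\<close>

text \<open>
  Unital complex algebras. The library class \<^class>\<open>real_algebra_1\<close> would in addition require
  \<open>0 \<noteq> 1\<close>, which fails for the operators on the zero space.
\<close>

class unital_complex_algebra = complex_vector + ring + monoid_mult +
  assumes mult_scaleC_left [simp]: "scaleC a x * y = scaleC a (x * y)"
    and mult_scaleC_right [simp]: "x * scaleC a y = scaleC a (x * y)"

definition gamma_n :: "nat \<Rightarrow> 'a \<Rightarrow> 'a \<Rightarrow> 'a::unital_complex_algebra" where
  "gamma_n n S T = (\<Sum>k=0..n. scaleC ((-1) ^ (n - k) * of_nat (n choose k)) (S ^ k * T ^ (n - k)))"

text \<open>\<open>'a bop\<close> is the algebra of bounded complex-linear operators on \<open>'a\<close>, with composition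
  as multiplication.\<close>

typedef (overloaded) 'a bop =
  "{T :: 'a::complex_inner \<Rightarrow> 'a. bounded_linear T \<and> (\<forall>c x. T (scaleC c x) = scaleC c (T x))}"
  morphisms apply_bop Bop
  by (rule exI[of _ "\<lambda>x. 0"]) (simp add: bounded_linear_zero)

setup_lifting type_definition_bop

instantiation bop :: (complex_inner) unital_complex_algebra
begin

lift_definition zero_bop :: "'a bop" is "\<lambda>x. 0"
  by (simp add: bounded_linear_zero)
lift_definition one_bop :: "'a bop" is "\<lambda>x. x"
  by (simp add: bounded_linear_ident)
lift_definition plus_bop :: "'a bop \<Rightarrow> 'a bop \<Rightarrow> 'a bop" is "\<lambda>S T x. S x + T x"
  by (simp add: bounded_linear_add scaleC_add_right)
lift_definition minus_bop :: "'a bop \<Rightarrow> 'a bop \<Rightarrow> 'a bop" is "\<lambda>S T x. S x - T x"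
  by (simp add: bounded_linear_sub scaleC_diff_right)
lift_definition uminus_bop :: "'a bop \<Rightarrow> 'a bop" is "\<lambda>T x. - T x"
  by (simp add: bounded_linear_minus scaleC_minus_right)
lift_definition times_bop :: "'a bop \<Rightarrow> 'a bop \<Rightarrow> 'a bop" is "\<lambda>S T x. S (T x)"
  by (simp add: bounded_linear_compose)
lift_definition scaleC_bop :: "complex \<Rightarrow> 'a bop \<Rightarrow> 'a bop" is "\<lambda>c T x. scaleC c (T x)"
  by (simp add: bounded_linear_compose[OF bounded_linear_scaleC] mult.commute)
lift_definition scaleR_bop :: "real \<Rightarrow> 'a bop \<Rightarrow> 'a bop" is "\<lambda>r T x. r *\<^sub>R T x"
  by (simp add: scaleR_scaleC bounded_linear_compose[OF bounded_linear_scaleC] mult.commute)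

instance
proof
  fix R S T :: "'a bop" and a b :: complex and r s :: real
  show "R + S + T = R + (S + T)" by transfer (simp add: add.assoc)
  show "R + S = S + R" by transfer (simp add: add.commute)
  show "0 + R = R" by transfer simp
  show "- R + R = 0" by transfer simp
  show "R - S = R + - S" by transfer simp
  show "R * S * T = R * (S * T)" by transfer simp
  show "(R + S) * T = R * T + S * T" by transfer simp
  show "R * (S + T) = R * S + R * T" by transfer (auto simp: fun_eq_iff linear_simps)
  show "1 * R = R" by transfer simp
  show "R * 1 = R" by transfer simp
  show "r *\<^sub>R (S + T) = r *\<^sub>R S + r *\<^sub>R T" by transfer (simp add: scaleR_add_right)
  show "(r + s) *\<^sub>R T = r *\<^sub>R T + s *\<^sub>R T" by transfer (simp add: scaleR_add_left)
  show "r *\<^sub>R s *\<^sub>R T = (r * s) *\<^sub>R T" by transfer simp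
  show "1 *\<^sub>R T = T" by transfer simp
  show "scaleC a (S + T) = scaleC a S + scaleC a T" by transfer (simp add: scaleC_add_right)
  show "scaleC (a + b) T = scaleC a T + scaleC b T" by transfer (simp add: scaleC_add_left)
  show "scaleC a (scaleC b T) = scaleC (a * b) T" by transfer simp
  show "r *\<^sub>R T = scaleC (complex_of_real r) T" by transfer (simp add: scaleR_scaleC)
  show "scaleC a S * T = scaleC a (S * T)" by transfer simp
  show "S * scaleC a T = scaleC a (S * T)" by transfer auto
qed

end

lemma bop_eqI: "(\<And>x. apply_bop S x = apply_bop T x) \<Longrightarrow> S = T"
  by transfer auto

lemma bounded_linear_apply_bop: "bounded_linear (apply_bop T)"
  by transfer simp

lemma apply_bop_scaleC [simp]: "apply_bop T (scaleC c x) = scaleC c (apply_bop T x)"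
  by transfer simp

lemmas apply_bop_add = linear_add[OF bounded_linear.linear[OF bounded_linear_apply_bop]]
lemmas tendsto_apply_bop [tendsto_intros] = bounded_linear.tendsto[OF bounded_linear_apply_bop]

lemma riesz_real:
  fixes g :: "'a::{real_inner, complete_space} \<Rightarrow> real"
  assumes "bounded_linear g"
  shows "\<exists>x. \<forall>y. g y = inner x y"
proof -
  interpret g: bounded_linear g by fact
  obtain B where B: "\<And>x. \<bar>g x\<bar> \<le> norm x * B"
    using g.bounded by auto
  define J where "J x = (norm x)\<^sup>2 - 2 * g x" for x
  have low: "- B\<^sup>2 \<le> J x" for x
  proof -
    have "0 \<le> (norm x - B)\<^sup>2" by simp
    then have "- B\<^sup>2 \<le> (norm x)\<^sup>2 - 2 * (norm x * B)"
      by (simp add: power2_eq_square algebra_simps)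
    then show ?thesis using B[of x] by (simp add: J_def)
  qed
  define m where "m = (INF x. J x)"
  have bdd: "bdd_below (range J)" using low by (auto intro!: bdd_belowI)
  have m: "m \<le> J x" for x unfolding m_def by (rule cINF_lower[OF bdd]) simp
  have "\<exists>x. J x < m + inverse (real (Suc n))" for n
    using cINF_less_iff[OF _ bdd, of "m + inverse (real (Suc n))"] by (simp add: m_def)
  then obtain X where X: "\<And>n. J (X n) < m + inverse (real (Suc n))" by metis
  have par: "(norm (x - y))\<^sup>2 \<le> 2 * (J x - m) + 2 * (J y - m)" for x y
  proof -
    have "(norm (x - y))\<^sup>2 = 2 * J x + 2 * J y - 4 * J ((1/2) *\<^sub>R (x + y))"
      by (simp add: J_def g.add g.scaleR power2_norm_eq_inner inner_commute algebra_simps)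
    then show ?thesis using m[of "(1/2) *\<^sub>R (x + y)"] by simp
  qed
  have "Cauchy X"
  proof (rule CauchyI)
    fix e :: real assume e: "0 < e"
    obtain N where N: "inverse (real (Suc N)) < e\<^sup>2 / 4"
      using reals_Archimedean[of "e\<^sup>2 / 4"] e by auto
    show "\<exists>M. \<forall>p\<ge>M. \<forall>q\<ge>M. norm (X p - X q) < e"
    proof (intro exI[of _ N] allI impI)
      fix p q assume pq: "N \<le> p" "N \<le> q"
      have small: "J (X r) - m < e\<^sup>2 / 4" if "N \<le> r" for r
      proof -
        have "inverse (real (Suc r)) \<le> inverse (real (Suc N))"
          using that by (intro le_imp_inverse_le) auto
        then show ?thesis using X[of r] N by linarith
      qed
      have "(norm (X p - X q))\<^sup>2 < e\<^sup>2"
        using par[of "X p" "X q"] small[OF pq(1)] small[OF pq(2)] by argo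
      then show "norm (X p - X q) < e"
        using e by (simp add: power_less_imp_less_base)
    qed
  qed
  then obtain x where x: "X \<longlonglongrightarrow> x"
    using Cauchy_convergent convergent_def by blast
  have "(\<lambda>n. J (X n)) \<longlonglongrightarrow> J x"
    unfolding J_def by (intro tendsto_intros x g.tendsto)
  moreover have "(\<lambda>n. m + inverse (real (Suc n))) \<longlonglongrightarrow> m + 0"
    by (intro tendsto_intros LIMSEQ_inverse_real_of_nat)
  ultimately have "J x \<le> m + 0"
    by (rule LIMSEQ_le) (use X less_imp_le in blast)
  then have min: "J x \<le> J y" for y using m[of y] by simp
  have "g y = inner x y" for y
  proof -
    define d where "d = inner x y - g y"
    define s where "s = (norm y)\<^sup>2"
    have s: "s \<ge> 0" by (simp add: s_def)
    have pos: "0 \<le> 2 * t * d + t\<^sup>2 * s" for t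
    proof -
      have "(norm (x + t *\<^sub>R y))\<^sup>2 = (norm x)\<^sup>2 + 2 * t * inner x y + t\<^sup>2 * s"
        unfolding s_def power2_norm_eq_inner
        by (simp add: inner_add inner_commute power2_eq_square algebra_simps)
      then have "J (x + t *\<^sub>R y) = J x + 2 * t * d + t\<^sup>2 * s"
        by (simp add: J_def d_def g.add g.scaleR algebra_simps)
      then show ?thesis using min[of "x + t *\<^sub>R y"] by simp
    qed
    have "d = 0"
    proof (rule ccontr)
      assume d: "d \<noteq> 0"
      have "0 \<le> 2 * (- d / (s + 1)) * d + (- d / (s + 1))\<^sup>2 * s" by (rule pos)
      also have "\<dots> = - (d\<^sup>2 * (s + 2)) / (s + 1)\<^sup>2"
        using s by (simp add: power2_eq_square divide_simps) (simp add: algebra_simps)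
      also have "\<dots> < 0"
        using s d by (intro divide_neg_pos) (auto intro!: mult_pos_pos)
      finally show False by simp
    qed
    then show ?thesis by (simp add: d_def)
  qed
  then show ?thesis by blast
qed

lemma riesz:
  fixes f :: "'a::chilbert_space \<Rightarrow> complex"
  assumes "bounded_linear f" and scale: "\<And>c x. f (scaleC c x) = c * f x"
  shows "\<exists>v. \<forall>y. f y = cinner v y"
proof -
  have "bounded_linear (\<lambda>y. Re (f y))"
    by (rule bounded_linear_compose[OF bounded_linear_Re assms(1)])
  then obtain v where v: "\<And>y. Re (f y) = inner v y" using riesz_real by blast
  have "f y = cinner v y" for y
  proof (rule complex_eqI)
    show "Re (f y) = Re (cinner v y)" by (simp add: v inner_eq_Re_cinner)
    show "Im (f y) = Im (cinner v y)"
      using v[of "scaleC (- \<i>) y"] by (simp add: scale inner_eq_Re_cinner)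
  qed
  then show ?thesis by blast
qed

definition adj :: "'a::chilbert_space bop \<Rightarrow> 'a bop" where
  "adj T = (THE S. \<forall>x y. cinner (apply_bop S x) y = cinner x (apply_bop T y))"

lemma adj_ex1:
  fixes T :: "'a::chilbert_space bop"
  shows "\<exists>!S. \<forall>x y. cinner (apply_bop S x) y = cinner x (apply_bop T y)"
proof (rule ex_ex1I)
  have "\<exists>v. \<forall>y. cinner x (apply_bop T y) = cinner v y" for x
    by (rule riesz)
       (simp_all add: bounded_linear_compose[OF
          bounded_bilinear.bounded_linear_right[OF bounded_bilinear_cinner] bounded_linear_apply_bop])
  then obtain S where S: "\<And>x y. cinner x (apply_bop T y) = cinner (S x) y" by metis
  obtain B where B: "\<And>x. norm (apply_bop T x) \<le> norm x * B" and "B \<ge> 0"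
    using bounded_linear.nonneg_bounded[OF bounded_linear_apply_bop] by blast
  have "bounded_linear S"
  proof (rule bounded_linear_intro[where K = B])
    show "S (x + y) = S x + S y" for x y
      by (rule cinner_ext_left) (simp add: cinner_add_left flip: S)
    show "S (r *\<^sub>R x) = r *\<^sub>R S x" for r x
      by (rule cinner_ext_left) (simp flip: S)
    show "norm (S x) \<le> norm x * B" for x
    proof (cases "S x = 0")
      case False
      have "(norm (S x))\<^sup>2 = cmod (cinner (S x) (S x))"
        by (simp add: cinner_self norm_power)
      also have "\<dots> \<le> norm x * norm (apply_bop T (S x))"
        unfolding S[symmetric] by (rule cinner_bound)
      also have "\<dots> \<le> norm x * (norm (S x) * B)"
        by (intro mult_left_mono B) simp
      finally have "norm (S x) * norm (S x) \<le> norm (S x) * (norm x * B)"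
        by (simp add: power2_eq_square algebra_simps)
      then show ?thesis using False by (simp add: mult_le_cancel_left)
    qed (simp add: \<open>B \<ge> 0\<close>)
  qed
  moreover have "S (scaleC c x) = scaleC c (S x)" for c x
    by (rule cinner_ext_left) (simp flip: S)
  ultimately have "apply_bop (Bop S) = S" by (simp add: Bop_inverse)
  then show "\<exists>S. \<forall>x y. cinner (apply_bop S x) y = cinner x (apply_bop T y)"
    using S by metis
qed (metis bop_eqI cinner_ext_left)

lemma cinner_adj_left: "cinner (apply_bop (adj T) x) y = cinner x (apply_bop T y)"
  using theI'[OF adj_ex1[of T]] unfolding adj_def by blast

definition n_symmetry :: "nat \<Rightarrow> 'a::chilbert_space bop \<Rightarrow> bool" where
  "n_symmetry n T \<longleftrightarrow> gamma_n n (adj T) T = 0"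

section \<open>The algebraic tensor product\<close>

text \<open>
  A list \<open>[(a1, b1), \<dots>, (ar, br)]\<close> stands for \<open>a1 \<otimes> b1 + \<dots> + ar \<otimes> br\<close>. Two such sums are
  equal in the algebraic tensor product iff all functionals \<open>\<langle>x, \<cdot>\<rangle> \<otimes> \<langle>y, \<cdot>\<rangle>\<close> agree on
  them, because these functionals separate the points of the tensor product.
\<close>

definition tform :: "('h::complex_inner \<times> 'k::complex_inner) list \<Rightarrow> 'h \<Rightarrow> 'k \<Rightarrow> complex" where
  "tform xs x y = (\<Sum>(a, b)\<leftarrow>xs. cinner x a * cinner y b)"

definition tinner :: "('h::complex_inner \<times> 'k::complex_inner) list \<Rightarrow> ('h \<times> 'k) list \<Rightarrow> complex" where
  "tinner xs ys = (\<Sum>(a, b)\<leftarrow>xs. \<Sum>(c, d)\<leftarrow>ys. cinner a c * cinner b d)"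

quotient_type (overloaded) ('h, 'k) atensor =
  "('h::complex_inner \<times> 'k::complex_inner) list" / "\<lambda>xs ys. \<forall>x y. tform xs x y = tform ys x y"
  by (auto intro!: equivpI reflpI sympI transpI)

lemma tform_Nil [simp]: "tform [] x y = 0"
  and tform_Cons [simp]: "tform (p # xs) x y = cinner x (fst p) * cinner y (snd p) + tform xs x y"
  and tform_append [simp]: "tform (xs @ ys) x y = tform xs x y + tform ys x y"
  by (simp_all add: tform_def split_beta)

lemma tform_scaleC: "tform (map (\<lambda>(a, b). (scaleC c a, b)) xs) x y = c * tform xs x y"
  by (induction xs) (auto simp: algebra_simps)

lemma tform_uminus: "tform (map (\<lambda>(a, b). (- a, b)) xs) x y = - tform xs x y"
  by (induction xs) (auto simp: algebra_simps)

lemma tinner_tform: "tinner xs ys = (\<Sum>(a, b)\<leftarrow>xs. tform ys a b)"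
  by (simp add: tinner_def tform_def)

lemma tinner_Nil [simp]: "tinner [] ys = 0"
  and tinner_Cons: "tinner (p # xs) ys = tform ys (fst p) (snd p) + tinner xs ys"
  by (simp_all add: tinner_tform split_beta)

lemma tinner_append_right: "tinner xs (ys @ zs) = tinner xs ys + tinner xs zs"
  by (induction xs) (simp_all add: tinner_Cons)

lemma tinner_scaleC_right: "tinner xs (map (\<lambda>(a, b). (scaleC c a, b)) ys) = c * tinner xs ys"
  by (induction xs) (simp_all add: tinner_Cons tform_scaleC algebra_simps)

lemma tinner_commute: "tinner xs ys = cnj (tinner ys xs)"
proof -
  have nil: "tinner ys [] = 0" for ys :: "('a \<times> 'b) list"
    by (induction ys) (simp_all add: tinner_Cons)
  have cons: "tinner ys (p # xs) = cnj (tform ys (fst p) (snd p)) + tinner ys xs"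
    for ys xs :: "('a \<times> 'b) list" and p
    by (induction ys)
       (simp_all add: tinner_Cons cinner_commute[symmetric] algebra_simps)
  show ?thesis
    by (induction xs) (simp_all add: nil cons tinner_Cons)
qed

lemma tinner_cong:
  assumes "\<forall>x y. tform xs x y = tform xs' x y" "\<forall>x y. tform ys x y = tform ys' x y"
  shows "tinner xs ys = tinner xs' ys'"
proof -
  have "tinner xs ys = tinner xs ys'" using assms(2) by (simp add: tinner_tform)
  also have "\<dots> = cnj (tinner ys' xs)" by (rule tinner_commute)
  also have "\<dots> = cnj (tinner ys' xs')" using assms(1) by (simp add: tinner_tform)
  also have "\<dots> = tinner xs' ys'" by (rule tinner_commute[symmetric])
  finally show ?thesis .
qed

lemma orthonormal_expansion:
  fixes S :: "'a::complex_inner set"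
  assumes "finite S"
  shows "\<exists>E. finite E \<and> (\<forall>e\<in>E. \<forall>f\<in>E. cinner e f = (if e = f then 1 else 0)) \<and>
    (\<forall>b\<in>S. b = (\<Sum>e\<in>E. scaleC (cinner e b) e))"
  using assms
proof (induction S)
  case empty
  show ?case by (intro exI[of _ "{}"]) simp
next
  case (insert b S)
  then obtain E where E: "finite E" "\<And>e f. e \<in> E \<Longrightarrow> f \<in> E \<Longrightarrow> cinner e f = (if e = f then 1 else 0)"
    "\<And>b. b \<in> S \<Longrightarrow> b = (\<Sum>e\<in>E. scaleC (cinner e b) e)" by metis
  define r where "r = b - (\<Sum>e\<in>E. scaleC (cinner e b) e)"
  have orth: "cinner e r = 0" if "e \<in> E" for e
  proof -
    have "cinner e r = cinner e b - (\<Sum>f\<in>E. cinner f b * (if e = f then 1 else 0))"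
      using that by (simp add: r_def cinner_diff_right cinner_sum_right E(2) cong: sum.cong)
    also have "(\<Sum>f\<in>E. cinner f b * (if e = f then 1 else 0)) = (\<Sum>f\<in>E. if e = f then cinner f b else 0)"
      by (rule sum.cong) auto
    also have "\<dots> = cinner e b" using E(1) that by simp
    finally show ?thesis by simp
  qed
  show ?case
  proof (cases "r = 0")
    case True
    then show ?thesis using E by (intro exI[of _ E]) (auto simp: r_def)
  next
    case False
    define e0 where "e0 = scaleC (of_real (1 / norm r)) r"
    have orth0: "cinner e e0 = 0" "cinner e0 e = 0" if "e \<in> E" for e
      using orth[OF that] cinner_commute[of e0 e] by (simp_all add: e0_def)
    have unit: "cinner e0 e0 = 1"
      using False by (simp add: e0_def cinner_self power2_eq_square norm_divide)
    have notin: "e0 \<notin> E" using orth0(1) unit by fastforce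
    have rr: "cinner r b = complex_of_real ((norm r)\<^sup>2)"
    proof -
      have "cinner r (\<Sum>e\<in>E. scaleC (cinner e b) e) = 0"
        unfolding cinner_sum_right
        by (rule sum.neutral) (use orth in \<open>simp add: cinner_commute[of r]\<close>)
      then have "cinner r b = cinner r r" by (simp add: r_def cinner_diff_right)
      then show ?thesis by (simp add: cinner_self)
    qed
    have "scaleC (cinner e0 b) e0 = r"
      using False by (simp add: e0_def rr power2_eq_square)
    then have "b = (\<Sum>e\<in>insert e0 E. scaleC (cinner e b) e)"
      using E(1) notin by (simp add: r_def)
    moreover have "c = (\<Sum>e\<in>insert e0 E. scaleC (cinner e c) e)" if "c \<in> S" for c
    proof -
      have "cinner e0 c = (\<Sum>e\<in>E. cinner e c * cinner e0 e)"
        by (subst E(3)[OF that]) (simp add: cinner_sum_right)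
      then have "cinner e0 c = 0" using orth0 by simp
      then show ?thesis using E(1,3) that notin by simp
    qed
    ultimately show ?thesis
      using E(1,2) orth0 unit notin by (intro exI[of _ "insert e0 E"]) auto
  qed
qed

definition tcoef :: "('h::complex_inner \<times> 'k::complex_inner) list \<Rightarrow> 'k \<Rightarrow> 'h" where
  "tcoef xs e = (\<Sum>(a, b)\<leftarrow>xs. scaleC (cinner e b) a)"

lemma tform_tcoef:
  assumes "b = (\<Sum>e\<in>E. scaleC (cinner e b) e)"
  shows "tform ys a b = (\<Sum>e\<in>E. cnj (cinner e b) * cinner a (tcoef ys e))"
proof (induction ys)
  case (Cons p ys)
  have "cinner b (snd p) = (\<Sum>e\<in>E. cnj (cinner e b) * cinner e (snd p))"
    by (subst (1) assms) (simp add: cinner_sum_left)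
  then show ?case using Cons
    by (simp add: tcoef_def split_beta cinner_add_right sum.distrib sum_distrib_left algebra_simps)
qed (simp add: tcoef_def)

lemma tinner_tcoef:
  assumes "\<forall>b\<in>snd ` set xs. b = (\<Sum>e\<in>E. scaleC (cinner e b) e)"
  shows "tinner xs ys = (\<Sum>e\<in>E. cinner (tcoef xs e) (tcoef ys e))"
  using assms
proof (induction xs)
  case (Cons p xs)
  have "tform ys (fst p) (snd p) = (\<Sum>e\<in>E. cnj (cinner e (snd p)) * cinner (fst p) (tcoef ys e))"
    by (rule tform_tcoef) (use Cons.prems in simp)
  then show ?case using Cons
    by (simp add: tinner_Cons tcoef_def split_beta cinner_add_left sum.distrib)
qed (simp add: tcoef_def)

lemma tinner_self:
  assumes "\<forall>b\<in>snd ` set xs. b = (\<Sum>e\<in>E. scaleC (cinner e b) e)"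
  shows "tinner xs xs = complex_of_real (\<Sum>e\<in>E. (norm (tcoef xs e))\<^sup>2)"
  by (simp add: tinner_tcoef[OF assms] cinner_self)

lemma tinner_nonneg: "0 \<le> Re (tinner xs xs)"
proof -
  have "finite (snd ` set xs)" by simp
  from orthonormal_expansion[OF this] obtain E where
    "\<forall>b\<in>snd ` set xs. b = (\<Sum>e\<in>E. scaleC (cinner e b) e)" by blast
  from tinner_self[OF this] show ?thesis by (simp add: sum_nonneg)
qed

lemma tinner_eq_0D:
  assumes "Re (tinner xs xs) = 0"
  shows "tform xs x y = 0"
proof -
  have "finite (insert y (snd ` set xs))" by simp
  from orthonormal_expansion[OF this] obtain E where E: "finite E"
    "\<forall>b\<in>insert y (snd ` set xs). b = (\<Sum>e\<in>E. scaleC (cinner e b) e)" by blast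
  then have "(\<Sum>e\<in>E. (norm (tcoef xs e))\<^sup>2) = 0"
    using assms tinner_self[of xs E] by simp
  then have "tcoef xs e = 0" if "e \<in> E" for e
    using E(1) that by (simp add: sum_nonneg_eq_0_iff)
  moreover have "tform xs x y = (\<Sum>e\<in>E. cnj (cinner e y) * cinner x (tcoef xs e))"
    by (rule tform_tcoef) (use E in simp)
  ultimately show ?thesis by simp
qed

instantiation atensor :: (complex_inner, complex_inner) complex_inner
begin

lift_definition zero_atensor :: "('a, 'b) atensor" is "[]" .
lift_definition plus_atensor :: "('a, 'b) atensor \<Rightarrow> ('a, 'b) atensor \<Rightarrow> ('a, 'b) atensor" is "(@)"
  by simp
lift_definition scaleC_atensor :: "complex \<Rightarrow> ('a, 'b) atensor \<Rightarrow> ('a, 'b) atensor"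
  is "\<lambda>c. map (\<lambda>(a, b). (scaleC c a, b))"
  by (simp add: tform_scaleC)
lift_definition uminus_atensor :: "('a, 'b) atensor \<Rightarrow> ('a, 'b) atensor"
  is "map (\<lambda>(a, b). (- a, b))"
  by (simp add: tform_uminus)
lift_definition cinner_atensor :: "('a, 'b) atensor \<Rightarrow> ('a, 'b) atensor \<Rightarrow> complex" is tinner
  by (rule tinner_cong) auto

definition minus_atensor :: "('a, 'b) atensor \<Rightarrow> ('a, 'b) atensor \<Rightarrow> ('a, 'b) atensor"
  where "minus_atensor x y = x + - y"
definition scaleR_atensor :: "real \<Rightarrow> ('a, 'b) atensor \<Rightarrow> ('a, 'b) atensor"
  where "scaleR_atensor r x = scaleC (complex_of_real r) x"
definition inner_atensor :: "('a, 'b) atensor \<Rightarrow> ('a, 'b) atensor \<Rightarrow> real"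
  where "inner_atensor x y = Re (cinner x y)"
definition norm_atensor :: "('a, 'b) atensor \<Rightarrow> real"
  where "norm_atensor x = sqrt (inner x x)"
definition dist_atensor :: "('a, 'b) atensor \<Rightarrow> ('a, 'b) atensor \<Rightarrow> real"
  where "dist_atensor x y = norm (x - y)"
definition sgn_atensor :: "('a, 'b) atensor \<Rightarrow> ('a, 'b) atensor"
  where "sgn_atensor x = scaleR (inverse (norm x)) x"
definition uniformity_atensor :: "(('a, 'b) atensor \<times> ('a, 'b) atensor) filter"
  where "uniformity_atensor = (INF e\<in>{0 <..}. principal {(x, y). dist x y < e})"
definition open_atensor :: "('a, 'b) atensor set \<Rightarrow> bool"
  where "open_atensor U \<longleftrightarrow> (\<forall>x\<in>U. eventually (\<lambda>(x', y). x' = x \<longrightarrow> y \<in> U) uniformity)"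

instance
proof
  fix x y z :: "('a, 'b) atensor" and a b :: complex and r s :: real
  show "x + y + z = x + (y + z)" by transfer (simp add: add.assoc)
  show comm: "x + y = y + x" for x y :: "('a, 'b) atensor" by transfer (simp add: add.commute)
  show "0 + x = x" by transfer simp
  show "- x + x = 0" by transfer (simp add: tform_uminus)
  show "x - y = x + - y" by (rule minus_atensor_def)
  show scA: "scaleC a (x + y) = scaleC a x + scaleC a y" for a and x y :: "('a, 'b) atensor"
    by transfer (simp add: tform_scaleC algebra_simps)
  show scB: "scaleC (a + b) x = scaleC a x + scaleC b x" for a b and x :: "('a, 'b) atensor"
    by transfer (simp add: tform_scaleC algebra_simps)
  show scC: "scaleC a (scaleC b x) = scaleC (a * b) x" for a b and x :: "('a, 'b) atensor"
    by transfer (simp add: tform_scaleC del: map_map)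
  have scD: "scaleC 1 x = x" for x :: "('a, 'b) atensor" by transfer (simp add: tform_scaleC)
  show "r *\<^sub>R x = scaleC (complex_of_real r) x" by (rule scaleR_atensor_def)
  show "r *\<^sub>R (x + y) = r *\<^sub>R x + r *\<^sub>R y" by (simp add: scaleR_atensor_def scA)
  show "(r + s) *\<^sub>R x = r *\<^sub>R x + s *\<^sub>R x" by (simp add: scaleR_atensor_def scB)
  show "r *\<^sub>R s *\<^sub>R x = (r * s) *\<^sub>R x" by (simp add: scaleR_atensor_def scC)
  show "1 *\<^sub>R x = x" by (simp add: scaleR_atensor_def scD)
  show ccomm: "cinner x y = cnj (cinner y x)" for x y :: "('a, 'b) atensor"
    by transfer (rule tinner_commute)
  show cadd: "cinner x (y + z) = cinner x y + cinner x z" for x y z :: "('a, 'b) atensor"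
    by transfer (rule tinner_append_right)
  show cscale: "cinner x (scaleC a y) = a * cinner x y" for a and x y :: "('a, 'b) atensor"
    by transfer (rule tinner_scaleC_right)
  show "inner x y = Re (cinner x y)" by (rule inner_atensor_def)
  show icomm: "inner x y = inner y x" for x y :: "('a, 'b) atensor"
    by (subst (1 2) inner_atensor_def) (subst ccomm, simp)
  have iadd: "inner x (y + z) = inner x y + inner x z" for x y z :: "('a, 'b) atensor"
    by (simp add: inner_atensor_def cadd)
  show "inner (x + y) z = inner x z + inner y z" by (metis iadd icomm)
  have "inner x (r *\<^sub>R y) = r * inner x y" for r and x y :: "('a, 'b) atensor"
    by (simp add: inner_atensor_def scaleR_atensor_def cscale)
  then show "inner (r *\<^sub>R x) y = r * inner x y" by (metis icomm)
  show "0 \<le> inner x x"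
    unfolding inner_atensor_def by transfer (rule tinner_nonneg)
  show "inner x x = 0 \<longleftrightarrow> x = 0"
    unfolding inner_atensor_def
  proof (transfer, intro iffI)
    fix xs :: "('a \<times> 'b) list"
    assume z: "Re (tinner xs xs) = 0"
    show "\<forall>x y. tform xs x y = tform [] x y" using tinner_eq_0D[OF z] by simp
  next
    fix xs :: "('a \<times> 'b) list"
    assume "\<forall>x y. tform xs x y = tform [] x y"
    then have "tinner xs xs = tinner xs []" by (intro tinner_cong) auto
    then show "Re (tinner xs xs) = 0" using tinner_commute[of xs "[]"] by simp
  qed
  show "norm x = sqrt (inner x x)" by (rule norm_atensor_def)
  show "dist x y = norm (x - y)" by (rule dist_atensor_def)
  show "sgn x = scaleR (inverse (norm x)) x" by (rule sgn_atensor_def)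
  show "uniformity = (INF e\<in>{0 <..}. principal {(x, y :: ('a, 'b) atensor). dist x y < e})"
    by (rule uniformity_atensor_def)
  show "open U \<longleftrightarrow> (\<forall>x\<in>U. eventually (\<lambda>(x', y). x' = x \<longrightarrow> y \<in> U) uniformity)"
    for U :: "('a, 'b) atensor set"
    by (rule open_atensor_def)
qed

end

lift_definition apure :: "'h::complex_inner \<Rightarrow> 'k::complex_inner \<Rightarrow> ('h, 'k) atensor"
  is "\<lambda>x y. [(x, y)]" .

lemma cinner_apure: "cinner (apure a b) (apure c d) = cinner a c * cinner b d"
  by transfer (simp add: tinner_def)

lemma apure_add_left: "apure (x + x') y = apure x y + apure x' y"
  and apure_add_right: "apure x (y + y') = apure x y + apure x y'"
  and apure_scaleC_left: "apure (scaleC c x) y = scaleC c (apure x y)"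
  and apure_scaleC_right: "apure x (scaleC c y) = scaleC c (apure x y)"
  by (transfer, simp add: cinner_add_right algebra_simps)+

lemma atensor_induct [case_names zero add]:
  assumes "P 0" and "\<And>x y z. P z \<Longrightarrow> P (apure x y + z)"
  shows "P z"
proof -
  have "P (abs_atensor xs)" for xs
  proof (induction xs)
    case Nil
    then show ?case using assms(1) by (simp add: zero_atensor.abs_eq)
  next
    case (Cons p xs)
    have "abs_atensor (p # xs) = apure (fst p) (snd p) + abs_atensor xs"
      by (simp add: apure.abs_eq plus_atensor.abs_eq)
    then show ?case using assms(2) Cons by simp
  qed
  then show ?thesis by (rule atensor.abs_induct)
qed

section \<open>Completion\<close>

lemma Cauchy_const [simp]: "Cauchy (\<lambda>n. c :: 'a::metric_space)"
  by (simp add: LIMSEQ_imp_Cauchy[OF tendsto_const])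

lemma Cauchy_plus:
  fixes X Y :: "nat \<Rightarrow> 'a::real_normed_vector"
  assumes "Cauchy X" "Cauchy Y"
  shows "Cauchy (\<lambda>n. X n + Y n)"
proof (rule CauchyI)
  fix e :: real assume e: "0 < e"
  obtain M where M: "\<And>m n. M \<le> m \<Longrightarrow> M \<le> n \<Longrightarrow> norm (X m - X n) < e / 2"
    using CauchyD[OF assms(1), of "e / 2"] e by auto
  obtain N where N: "\<And>m n. N \<le> m \<Longrightarrow> N \<le> n \<Longrightarrow> norm (Y m - Y n) < e / 2"
    using CauchyD[OF assms(2), of "e / 2"] e by auto
  show "\<exists>M. \<forall>m\<ge>M. \<forall>n\<ge>M. norm (X m + Y m - (X n + Y n)) < e"
  proof (intro exI[of _ "max M N"] allI impI)
    fix m n assume "max M N \<le> m" "max M N \<le> n"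
    then have "norm (X m - X n) + norm (Y m - Y n) < e" using M[of m n] N[of m n] by simp
    then show "norm (X m + Y m - (X n + Y n)) < e"
      using norm_diff_triangle_ineq[of "X m" "Y m" "X n" "Y n"] by linarith
  qed
qed

lemma Cauchy_neg:
  fixes X :: "nat \<Rightarrow> 'a::real_normed_vector"
  shows "Cauchy X \<Longrightarrow> Cauchy (\<lambda>n. - X n)"
  by (rule bounded_linear.Cauchy[OF bounded_linear_minus[OF bounded_linear_ident]])

lemma Cauchy_cinner_convergent:
  fixes X Y :: "nat \<Rightarrow> 'a::complex_inner"
  assumes X: "Cauchy X" and Y: "Cauchy Y"
  shows "(\<lambda>n. cinner (X n) (Y n)) \<longlonglongrightarrow> lim (\<lambda>n. cinner (X n) (Y n))"
proof -
  obtain A where A: "A > 0" "\<And>n. norm (X n) \<le> A" using Cauchy_Bseq[OF X] by (auto elim: BseqE)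
  obtain B where B: "B > 0" "\<And>n. norm (Y n) \<le> B" using Cauchy_Bseq[OF Y] by (auto elim: BseqE)
  have "Cauchy (\<lambda>n. cinner (X n) (Y n))"
  proof (rule CauchyI)
    fix e :: real assume e: "0 < e"
    obtain M where M: "\<And>m n. M \<le> m \<Longrightarrow> M \<le> n \<Longrightarrow> norm (X m - X n) < e / (2 * B)"
      using CauchyD[OF X, of "e / (2 * B)"] e B by auto
    obtain N where N: "\<And>m n. N \<le> m \<Longrightarrow> N \<le> n \<Longrightarrow> norm (Y m - Y n) < e / (2 * A)"
      using CauchyD[OF Y, of "e / (2 * A)"] e A by auto
    show "\<exists>M. \<forall>m\<ge>M. \<forall>n\<ge>M. norm (cinner (X m) (Y m) - cinner (X n) (Y n)) < e"
    proof (intro exI[of _ "max M N"] allI impI)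
      fix m n assume mn: "max M N \<le> m" "max M N \<le> n"
      have "cinner (X m) (Y m) - cinner (X n) (Y n) =
          cinner (X m - X n) (Y m) + cinner (X n) (Y m - Y n)"
        by (simp add: cinner_diff_left cinner_diff_right)
      also have "norm \<dots> \<le> norm (X m - X n) * norm (Y m) + norm (X n) * norm (Y m - Y n)"
        by (intro order.trans[OF norm_triangle_ineq] add_mono cinner_bound)
      also have "\<dots> \<le> norm (X m - X n) * B + A * norm (Y m - Y n)"
        by (intro add_mono mult_mono A B) (use A B in auto)
      also have "\<dots> < e / (2 * B) * B + A * (e / (2 * A))"
        using M[of m n] N[of m n] mn A B
        by (intro add_strict_mono mult_strict_right_mono mult_strict_left_mono) auto
      also have "\<dots> = e" using A B by simp
      finally show "norm (cinner (X m) (Y m) - cinner (X n) (Y n)) < e" .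
    qed
  qed
  then show ?thesis by (simp add: Cauchy_convergent_iff convergent_LIMSEQ_iff)
qed

quotient_type (overloaded) 'a completion = "nat \<Rightarrow> 'a::complex_inner" /
  partial: "\<lambda>X Y. Cauchy X \<and> Cauchy Y \<and> (\<lambda>n. X n - Y n) \<longlonglongrightarrow> 0"
proof (rule part_equivpI)
  show "\<exists>X :: nat \<Rightarrow> 'a. Cauchy X \<and> Cauchy X \<and> (\<lambda>n. X n - X n) \<longlonglongrightarrow> 0"
    by (rule exI[of _ "\<lambda>n. 0"]) simp
  show "symp (\<lambda>X Y :: nat \<Rightarrow> 'a. Cauchy X \<and> Cauchy Y \<and> (\<lambda>n. X n - Y n) \<longlonglongrightarrow> 0)"
  proof (rule sympI, elim conjE, intro conjI)
    fix X Y :: "nat \<Rightarrow> 'a"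
    assume "(\<lambda>n. X n - Y n) \<longlonglongrightarrow> 0"
    from tendsto_minus[OF this] show "(\<lambda>n. Y n - X n) \<longlonglongrightarrow> 0" by simp
  qed
  show "transp (\<lambda>X Y :: nat \<Rightarrow> 'a. Cauchy X \<and> Cauchy Y \<and> (\<lambda>n. X n - Y n) \<longlonglongrightarrow> 0)"
  proof (rule transpI, elim conjE, intro conjI)
    fix X Y Z :: "nat \<Rightarrow> 'a"
    assume "(\<lambda>n. X n - Y n) \<longlonglongrightarrow> 0" "(\<lambda>n. Y n - Z n) \<longlonglongrightarrow> 0"
    from tendsto_add[OF this] show "(\<lambda>n. X n - Z n) \<longlonglongrightarrow> 0" by simp
  qed
qed

instantiation completion :: (complex_inner) complex_inner
begin

lift_definition zero_completion :: "'a completion" is "\<lambda>n. 0" by simp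
lift_definition plus_completion :: "'a completion \<Rightarrow> 'a completion \<Rightarrow> 'a completion"
  is "\<lambda>X Y n. X n + Y n"
proof (elim conjE, intro conjI Cauchy_plus)
  fix X X' Y Y' :: "nat \<Rightarrow> 'a"
  assume "(\<lambda>n. X n - X' n) \<longlonglongrightarrow> 0" "(\<lambda>n. Y n - Y' n) \<longlonglongrightarrow> 0"
  from tendsto_add[OF this] show "(\<lambda>n. X n + Y n - (X' n + Y' n)) \<longlonglongrightarrow> 0"
    by (simp add: add_diff_add)
qed
lift_definition uminus_completion :: "'a completion \<Rightarrow> 'a completion" is "\<lambda>X n. - X n"
proof (elim conjE, intro conjI Cauchy_neg)
  fix X X' :: "nat \<Rightarrow> 'a"
  assume "(\<lambda>n. X n - X' n) \<longlonglongrightarrow> 0"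
  from tendsto_minus[OF this] show "(\<lambda>n. - X n - - X' n) \<longlonglongrightarrow> 0" by simp
qed
lift_definition scaleC_completion :: "complex \<Rightarrow> 'a completion \<Rightarrow> 'a completion"
  is "\<lambda>c X n. scaleC c (X n)"
proof (elim conjE, intro conjI bounded_linear.Cauchy[OF bounded_linear_scaleC])
  fix c and X X' :: "nat \<Rightarrow> 'a"
  assume "(\<lambda>n. X n - X' n) \<longlonglongrightarrow> 0"
  from tendsto_scaleC[OF this, of c] show "(\<lambda>n. scaleC c (X n) - scaleC c (X' n)) \<longlonglongrightarrow> 0"
    by (simp add: scaleC_diff_right)
qed
lift_definition cinner_completion :: "'a completion \<Rightarrow> 'a completion \<Rightarrow> complex"
  is "\<lambda>X Y. lim (\<lambda>n. cinner (X n) (Y n))"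
proof (elim conjE)
  fix X X' Y Y' :: "nat \<Rightarrow> 'a"
  assume C: "Cauchy X" "Cauchy X'" "Cauchy Y" "Cauchy Y'"
    and d: "(\<lambda>n. X n - X' n) \<longlonglongrightarrow> 0" "(\<lambda>n. Y n - Y' n) \<longlonglongrightarrow> 0"
  have "(\<lambda>n. cinner (X n - X' n) (Y n) + cinner (X' n) (Y n - Y' n)) \<longlonglongrightarrow> 0"
  proof (rule tendsto_add_zero)
    show "(\<lambda>n. cinner (X n - X' n) (Y n)) \<longlonglongrightarrow> 0"
      using d(1) Cauchy_Bseq[OF C(3)] unfolding tendsto_Zfun_iff diff_0_right
      by (rule bounded_bilinear.Zfun_prod_Bfun[OF bounded_bilinear_cinner])
    show "(\<lambda>n. cinner (X' n) (Y n - Y' n)) \<longlonglongrightarrow> 0"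
      using Cauchy_Bseq[OF C(2)] d(2) unfolding tendsto_Zfun_iff diff_0_right
      by (rule bounded_bilinear.Bfun_prod_Zfun[OF bounded_bilinear_cinner])
  qed
  then have "(\<lambda>n. cinner (X n) (Y n) - cinner (X' n) (Y' n)) \<longlonglongrightarrow> 0"
    by (simp add: cinner_diff_left cinner_diff_right)
  from tendsto_add[OF this Cauchy_cinner_convergent[OF C(2,4)]]
  have "(\<lambda>n. cinner (X n) (Y n)) \<longlonglongrightarrow> lim (\<lambda>n. cinner (X' n) (Y' n))" by simp
  then show "lim (\<lambda>n. cinner (X n) (Y n)) = lim (\<lambda>n. cinner (X' n) (Y' n))"
    by (rule limI)
qed

definition minus_completion :: "'a completion \<Rightarrow> 'a completion \<Rightarrow> 'a completion"
  where "minus_completion x y = x + - y"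
definition scaleR_completion :: "real \<Rightarrow> 'a completion \<Rightarrow> 'a completion"
  where "scaleR_completion r x = scaleC (complex_of_real r) x"
definition inner_completion :: "'a completion \<Rightarrow> 'a completion \<Rightarrow> real"
  where "inner_completion x y = Re (cinner x y)"
definition norm_completion :: "'a completion \<Rightarrow> real"
  where "norm_completion x = sqrt (inner x x)"
definition dist_completion :: "'a completion \<Rightarrow> 'a completion \<Rightarrow> real"
  where "dist_completion x y = norm (x - y)"
definition sgn_completion :: "'a completion \<Rightarrow> 'a completion"
  where "sgn_completion x = scaleR (inverse (norm x)) x"
definition uniformity_completion :: "('a completion \<times> 'a completion) filter"
  where "uniformity_completion = (INF e\<in>{0 <..}. principal {(x, y). dist x y < e})"
definition open_completion :: "'a completion set \<Rightarrow> bool"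
  where "open_completion U \<longleftrightarrow> (\<forall>x\<in>U. eventually (\<lambda>(x', y). x' = x \<longrightarrow> y \<in> U) uniformity)"

lemma completion_cases:
  obtains X where "Cauchy X" "z = abs_completion X"
  by (induction z rule: completion.abs_induct) auto

lemma abs_completion_eqI:
  "Cauchy X \<Longrightarrow> Cauchy Y \<Longrightarrow> (\<lambda>n. X n - Y n) \<longlonglongrightarrow> 0 \<Longrightarrow> abs_completion X = abs_completion Y"
  by (rule Quotient_rel_abs[OF Quotient_completion]) simp

lemma plus_abs_completion:
  "Cauchy X \<Longrightarrow> Cauchy Y \<Longrightarrow> abs_completion X + abs_completion Y = abs_completion (\<lambda>n. X n + Y n)"
  by (rule plus_completion.abs_eq) simp_all

lemma uminus_abs_completion: "Cauchy X \<Longrightarrow> - abs_completion X = abs_completion (\<lambda>n. - X n)"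
  by (rule uminus_completion.abs_eq) simp

lemma scaleC_abs_completion:
  "Cauchy X \<Longrightarrow> scaleC c (abs_completion X) = abs_completion (\<lambda>n. scaleC c (X n))"
  by (rule scaleC_completion.abs_eq) simp

lemma tendsto_cinner_completion:
  assumes "Cauchy X" "Cauchy Y"
  shows "(\<lambda>n. cinner (X n) (Y n)) \<longlonglongrightarrow> cinner (abs_completion X) (abs_completion Y)"
proof -
  have "cinner (abs_completion X) (abs_completion Y) = lim (\<lambda>n. cinner (X n) (Y n))"
    using assms by (intro cinner_completion.abs_eq) simp_all
  then show ?thesis using Cauchy_cinner_convergent[OF assms] by simp
qed

lemmas Cauchy_scaleC = bounded_linear.Cauchy[OF bounded_linear_scaleC]

instance
proof
  fix x y z :: "'a completion" and a b :: complex and r s :: real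
  obtain X where X: "Cauchy X" "x = abs_completion X" by (rule completion_cases)
  obtain Y where Y: "Cauchy Y" "y = abs_completion Y" by (rule completion_cases)
  obtain Z where Z: "Cauchy Z" "z = abs_completion Z" by (rule completion_cases)
  note C = X(1) Y(1) Z(1)
  note abs = plus_abs_completion uminus_abs_completion scaleC_abs_completion
    Cauchy_plus Cauchy_neg Cauchy_scaleC
  show "x + y + z = x + (y + z)" using C by (simp add: X(2) Y(2) Z(2) abs add.assoc)
  show "x + y = y + x" using C by (simp add: X(2) Y(2) abs add.commute)
  show "0 + x = x" using C by (simp add: X(2) zero_completion_def abs)
  show "- x + x = 0" using C by (simp add: X(2) zero_completion_def abs)
  show "x - y = x + - y" by (rule minus_completion_def)
  show sc1: "scaleC a (x + y) = scaleC a x + scaleC a y" for a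
    using C by (simp add: X(2) Y(2) abs scaleC_add_right)
  show sc2: "scaleC (a + b) x = scaleC a x + scaleC b x" for a b
    using C by (simp add: X(2) abs scaleC_add_left)
  show sc3: "scaleC a (scaleC b x) = scaleC (a * b) x" for a b
    using C by (simp add: X(2) abs)
  show "r *\<^sub>R x = scaleC (complex_of_real r) x" by (rule scaleR_completion_def)
  show "r *\<^sub>R (x + y) = r *\<^sub>R x + r *\<^sub>R y" by (simp add: scaleR_completion_def sc1)
  show "(r + s) *\<^sub>R x = r *\<^sub>R x + s *\<^sub>R x" by (simp add: scaleR_completion_def sc2)
  show "r *\<^sub>R s *\<^sub>R x = (r * s) *\<^sub>R x" by (simp add: scaleR_completion_def sc3)
  show "1 *\<^sub>R x = x" using C by (simp add: scaleR_completion_def X(2) abs)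
  show "inner x y = Re (cinner x y)" by (rule inner_completion_def)
  show ccomm: "cinner x y = cnj (cinner y x)" for x y :: "'a completion"
  proof -
    obtain X where X: "Cauchy X" "x = abs_completion X" by (rule completion_cases)
    obtain Y where Y: "Cauchy Y" "y = abs_completion Y" by (rule completion_cases)
    have "(\<lambda>n. cnj (cinner (Y n) (X n))) \<longlonglongrightarrow> cnj (cinner y x)"
      unfolding X(2) Y(2) by (intro tendsto_cnj tendsto_cinner_completion X Y)
    then have "(\<lambda>n. cinner (X n) (Y n)) \<longlonglongrightarrow> cnj (cinner y x)"
      by (simp flip: cinner_commute)
    then show ?thesis
      using tendsto_cinner_completion[OF X(1) Y(1)] unfolding X(2) Y(2) by (rule LIMSEQ_unique[rotated])
  qed
  have cadd: "cinner x (y + z) = cinner x y + cinner x z" for x y z :: "'a completion"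
  proof -
    obtain X where X: "Cauchy X" "x = abs_completion X" by (rule completion_cases)
    obtain Y where Y: "Cauchy Y" "y = abs_completion Y" by (rule completion_cases)
    obtain Z where Z: "Cauchy Z" "z = abs_completion Z" by (rule completion_cases)
    have "(\<lambda>n. cinner (X n) (Y n + Z n)) \<longlonglongrightarrow> cinner x (y + z)"
      unfolding X(2) Y(2) Z(2) plus_abs_completion[OF Y(1) Z(1)]
      by (intro tendsto_cinner_completion X Y Z Cauchy_plus)
    moreover have "(\<lambda>n. cinner (X n) (Y n + Z n)) \<longlonglongrightarrow> cinner x y + cinner x z"
      unfolding X(2) Y(2) Z(2) cinner_add_right
      by (intro tendsto_add tendsto_cinner_completion X Y Z)
    ultimately show ?thesis by (rule LIMSEQ_unique)
  qed
  then show "cinner x (y + z) = cinner x y + cinner x z" .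
  have csc: "cinner x (scaleC a y) = a * cinner x y" for x y :: "'a completion" and a
  proof -
    obtain X where X: "Cauchy X" "x = abs_completion X" by (rule completion_cases)
    obtain Y where Y: "Cauchy Y" "y = abs_completion Y" by (rule completion_cases)
    have "(\<lambda>n. cinner (X n) (scaleC a (Y n))) \<longlonglongrightarrow> cinner x (scaleC a y)"
      unfolding X(2) Y(2) scaleC_abs_completion[OF Y(1)]
      by (intro tendsto_cinner_completion X Y Cauchy_scaleC)
    moreover have "(\<lambda>n. cinner (X n) (scaleC a (Y n))) \<longlonglongrightarrow> a * cinner x y"
      unfolding X(2) Y(2) cinner_scaleC_right
      by (intro tendsto_mult tendsto_const tendsto_cinner_completion X Y)
    ultimately show ?thesis by (rule LIMSEQ_unique)
  qed
  then show "cinner x (scaleC a y) = a * cinner x y" .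
  show icomm: "inner x y = inner y x" for x y :: "'a completion"
    unfolding inner_completion_def by (subst ccomm) simp
  have "inner x (y + z) = inner x y + inner x z" for x y z :: "'a completion"
    by (simp add: inner_completion_def cadd)
  then show "inner (x + y) z = inner x z + inner y z" by (simp add: icomm[of _ z])
  have "inner x (r *\<^sub>R y) = r * inner x y" for r and x y :: "'a completion"
    by (simp add: inner_completion_def scaleR_completion_def csc)
  then show "inner (r *\<^sub>R x) y = r * inner x y" by (simp add: icomm[of _ y])
  have lim: "(\<lambda>n. (norm (X n))\<^sup>2) \<longlonglongrightarrow> inner x x"
    using tendsto_Re[OF tendsto_cinner_completion[OF X(1) X(1)]]
    by (simp add: inner_completion_def X(2) cinner_self)
  show "0 \<le> inner x x" by (rule LIMSEQ_le_const[OF lim]) simp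
  show "inner x x = 0 \<longleftrightarrow> x = 0"
  proof
    assume "inner x x = 0"
    then have "(\<lambda>n. sqrt ((norm (X n))\<^sup>2)) \<longlonglongrightarrow> sqrt 0"
      using lim by (intro tendsto_real_sqrt) simp
    then have "X \<longlonglongrightarrow> 0" by (simp add: tendsto_norm_zero_iff)
    then show "x = 0" unfolding X(2) zero_completion_def
      by (intro abs_completion_eqI X) simp_all
  next
    assume "x = 0"
    have "cinner x (scaleC 0 x) = 0 * cinner x x" by (rule csc)
    moreover have "scaleC 0 x = 0"
      using C by (simp add: X(2) zero_completion_def abs)
    ultimately show "inner x x = 0" using \<open>x = 0\<close> by (simp add: inner_completion_def)
  qed
  show "norm x = sqrt (inner x x)" by (rule norm_completion_def)
  show "dist x y = norm (x - y)" by (rule dist_completion_def)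
  show "sgn x = scaleR (inverse (norm x)) x" by (rule sgn_completion_def)
  show "uniformity = (INF e\<in>{0 <..}. principal {(x, y :: 'a completion). dist x y < e})"
    by (rule uniformity_completion_def)
  show "open U \<longleftrightarrow> (\<forall>x\<in>U. eventually (\<lambda>(x', y). x' = x \<longrightarrow> y \<in> U) uniformity)"
    for U :: "'a completion set"
    by (rule open_completion_def)
qed

end

definition cembed :: "'a::complex_inner \<Rightarrow> 'a completion" where
  "cembed v = abs_completion (\<lambda>n. v)"

lemma cembed_add: "cembed (v + w) = cembed v + cembed w"
  by (simp add: cembed_def plus_abs_completion)

lemma cembed_scaleC: "cembed (scaleC c v) = scaleC c (cembed v)"
  by (simp add: cembed_def scaleC_abs_completion)

lemma cembed_zero [simp]: "cembed 0 = 0"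
  by (simp add: cembed_def zero_completion_def)

lemma cembed_diff: "cembed (v - w) = cembed v - cembed w"
  using cembed_add[of "v - w" w] by simp

lemma cinner_cembed [simp]: "cinner (cembed v) (cembed w) = cinner v w"
  using tendsto_cinner_completion[of "\<lambda>n. v" "\<lambda>n. w"] by (simp add: cembed_def LIMSEQ_const_iff)

lemma norm_cembed [simp]: "norm (cembed v) = norm v"
  by (simp add: norm_eq_sqrt_inner inner_eq_Re_cinner)

lemma tendsto_norm_completion:
  assumes "Cauchy X"
  shows "(\<lambda>n. norm (X n)) \<longlonglongrightarrow> norm (abs_completion X)"
  unfolding norm_eq_sqrt_inner inner_eq_Re_cinner
  by (intro tendsto_real_sqrt tendsto_Re tendsto_cinner_completion assms)

lemma cembed_tendsto:
  assumes X: "Cauchy X"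
  shows "(\<lambda>n. cembed (X n)) \<longlonglongrightarrow> abs_completion X"
proof (rule LIMSEQ_I)
  fix e :: real assume e: "0 < e"
  obtain M where M: "\<And>m n. M \<le> m \<Longrightarrow> M \<le> n \<Longrightarrow> norm (X m - X n) < e / 2"
    using CauchyD[OF X, of "e / 2"] e by auto
  show "\<exists>M. \<forall>m\<ge>M. norm (cembed (X m) - abs_completion X) < e"
  proof (intro exI[of _ M] allI impI)
    fix m assume m: "M \<le> m"
    have C: "Cauchy (\<lambda>n. X m + - X n)"
      by (intro Cauchy_plus Cauchy_neg X) simp
    have eq: "cembed (X m) - abs_completion X = abs_completion (\<lambda>n. X m + - X n)"
      using X by (simp add: cembed_def minus_completion_def uminus_abs_completion
          plus_abs_completion Cauchy_neg)
    have "norm (abs_completion (\<lambda>n. X m + - X n)) \<le> e / 2"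
      by (rule LIMSEQ_le_const2[OF tendsto_norm_completion[OF C]])
         (use M[OF m] in \<open>auto intro!: exI[of _ M] less_imp_le\<close>)
    then show "norm (cembed (X m) - abs_completion X) < e" using e by (simp add: eq)
  qed
qed

instance completion :: (complex_inner) chilbert_space
proof
  fix S :: "nat \<Rightarrow> 'a completion"
  assume S: "Cauchy S"
  have "\<exists>v. norm (S n - cembed v) < inverse (real (Suc n))" for n
  proof -
    obtain X where X: "Cauchy X" "S n = abs_completion X" by (rule completion_cases)
    obtain k where "norm (cembed (X k) - S n) < inverse (real (Suc n))"
      using LIMSEQ_D[OF cembed_tendsto[OF X(1)], of "inverse (real (Suc n))"] X(2) by auto
    then show ?thesis by (metis norm_minus_commute)
  qed
  then obtain v where v: "\<And>n. norm (S n - cembed (v n)) < inverse (real (Suc n))" by metis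
  have diff: "(\<lambda>n. S n - cembed (v n)) \<longlonglongrightarrow> 0"
    by (rule Lim_null_comparison[OF _ LIMSEQ_inverse_real_of_nat])
       (use v in \<open>auto intro!: always_eventually less_imp_le\<close>)
  have "Cauchy (\<lambda>n. S n + - (S n - cembed (v n)))"
    by (intro Cauchy_plus Cauchy_neg S LIMSEQ_imp_Cauchy[OF diff])
  then have "Cauchy (\<lambda>n. cembed (v n))" by simp
  then have "Cauchy v"
    by (simp add: Cauchy_iff flip: cembed_diff)
  from tendsto_add[OF diff cembed_tendsto[OF this]] show "convergent S"
    by (auto simp: convergent_def)
qed

section \<open>The Hilbert space tensor product\<close>

type_synonym ('h, 'k) htensor = "('h, 'k) atensor completion"

definition tensor_vec :: "'h::complex_inner \<Rightarrow> 'k::complex_inner \<Rightarrow> ('h, 'k) htensor"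
    (infixr "\<otimes>\<^sub>v" 70)
  where "x \<otimes>\<^sub>v y = cembed (apure x y)"

lemma cinner_tensor_vec: "cinner (a \<otimes>\<^sub>v b) (c \<otimes>\<^sub>v d) = cinner a c * cinner b d"
  by (simp add: tensor_vec_def cinner_apure)

lemma bop_eqI_tensor_vec:
  fixes C D :: "('h::complex_inner, 'k::complex_inner) htensor bop"
  assumes "\<And>x y. apply_bop C (x \<otimes>\<^sub>v y) = apply_bop D (x \<otimes>\<^sub>v y)"
  shows "C = D"
proof (rule bop_eqI)
  fix z :: "('h, 'k) htensor"
  have zero: "apply_bop T 0 = 0" for T :: "('h, 'k) htensor bop"
    using apply_bop_scaleC[of T 0 0] by simp
  have eq: "apply_bop C (cembed v) = apply_bop D (cembed v)" for v :: "('h, 'k) atensor"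
    by (induction v rule: atensor_induct)
       (simp_all add: zero cembed_add apply_bop_add assms flip: tensor_vec_def)
  obtain X where X: "Cauchy X" "z = abs_completion X" by (rule completion_cases)
  have "(\<lambda>n. apply_bop C (cembed (X n))) \<longlonglongrightarrow> apply_bop C z"
    unfolding X(2) by (intro tendsto_apply_bop cembed_tendsto X)
  moreover have "(\<lambda>n. apply_bop C (cembed (X n))) \<longlonglongrightarrow> apply_bop D z"
    unfolding X(2) eq by (intro tendsto_apply_bop cembed_tendsto X)
  ultimately show "apply_bop C z = apply_bop D z" by (rule LIMSEQ_unique)
qed

lemma bop_extend_completion:
  fixes f :: "'a::complex_inner \<Rightarrow> 'a"
  assumes f: "bounded_linear f" and sc: "\<And>c x. f (scaleC c x) = scaleC c (f x)"
  shows "\<exists>C. \<forall>v. apply_bop C (cembed v) = cembed (f v)"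
proof -
  interpret f: bounded_linear f by (rule f)
  define F where "F z = abs_completion (\<lambda>n. f ((SOME X. Cauchy X \<and> z = abs_completion X) n))" for z
  have F: "F (abs_completion X) = abs_completion (\<lambda>n. f (X n))" if X: "Cauchy X" for X
  proof -
    define Y where "Y = (SOME Y. Cauchy Y \<and> abs_completion X = abs_completion Y)"
    have Y: "Cauchy Y \<and> abs_completion X = abs_completion Y"
      unfolding Y_def by (rule someI[of _ X]) (simp add: X)
    have CY: "Cauchy (\<lambda>n. Y n + - X n)" by (intro Cauchy_plus Cauchy_neg X) (use Y in simp)
    have "abs_completion (\<lambda>n. Y n + - X n) = abs_completion Y + - abs_completion X"
      using plus_abs_completion[of Y "\<lambda>n. - X n"] uminus_abs_completion[OF X] X Y Cauchy_neg[OF X]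
      by simp
    also have "\<dots> = 0" using Y by simp
    finally have "(\<lambda>n. norm (Y n + - X n)) \<longlonglongrightarrow> 0"
      using tendsto_norm_completion[OF CY] by simp
    then have "(\<lambda>n. Y n - X n) \<longlonglongrightarrow> 0" by (simp add: tendsto_norm_zero_iff)
    from f.tendsto[OF this] have "(\<lambda>n. f (Y n) - f (X n)) \<longlonglongrightarrow> 0"
      by (simp add: f.diff f.zero)
    then have "abs_completion (\<lambda>n. f (Y n)) = abs_completion (\<lambda>n. f (X n))"
      using X Y by (intro abs_completion_eqI f.Cauchy) auto
    then show ?thesis by (simp add: F_def Y_def)
  qed
  obtain B where B: "\<And>x. norm (f x) \<le> norm x * B" using f.bounded by blast
  have "bounded_linear F"
  proof (rule bounded_linear_intro[where K = B])
    show "F (x + y) = F x + F y" for x y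
    proof -
      obtain X where X: "Cauchy X" "x = abs_completion X" by (rule completion_cases)
      obtain Y where Y: "Cauchy Y" "y = abs_completion Y" by (rule completion_cases)
      show ?thesis using X(1) Y(1)
        by (simp add: X(2) Y(2) plus_abs_completion F Cauchy_plus f.Cauchy f.add)
    qed
    show "F (r *\<^sub>R x) = r *\<^sub>R F x" for r x
    proof -
      obtain X where X: "Cauchy X" "x = abs_completion X" by (rule completion_cases)
      show ?thesis using X(1)
        by (simp add: X(2) scaleR_scaleC scaleC_abs_completion F Cauchy_scaleC f.Cauchy sc)
    qed
    show "norm (F x) \<le> norm x * B" for x
    proof -
      obtain X where X: "Cauchy X" "x = abs_completion X" by (rule completion_cases)
      have "(\<lambda>n. norm (f (X n))) \<longlonglongrightarrow> norm (F x)"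
        unfolding X(2) F[OF X(1)] by (intro tendsto_norm_completion f.Cauchy X)
      moreover have "(\<lambda>n. norm (X n) * B) \<longlonglongrightarrow> norm x * B"
        unfolding X(2) by (intro tendsto_mult tendsto_const tendsto_norm_completion X)
      ultimately show ?thesis by (rule LIMSEQ_le) (use B in auto)
    qed
  qed
  moreover have "F (scaleC c x) = scaleC c (F x)" for c x
  proof -
    obtain X where X: "Cauchy X" "x = abs_completion X" by (rule completion_cases)
    show ?thesis using X(1)
      by (simp add: X(2) scaleC_abs_completion F Cauchy_scaleC f.Cauchy sc)
  qed
  ultimately have "apply_bop (Bop F) = F" by (simp add: Bop_inverse)
  then have "apply_bop (Bop F) (cembed v) = cembed (f v)" for v
    using F[of "\<lambda>n. v"] by (simp add: cembed_def)
  then show ?thesis by blast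
qed

definition tmap :: "('h::chilbert_space \<Rightarrow> 'h) \<Rightarrow> ('k::chilbert_space \<Rightarrow> 'k) \<Rightarrow>
    ('h \<times> 'k) list \<Rightarrow> ('h \<times> 'k) list"
  where "tmap A B = map (\<lambda>(a, b). (A a, B b))"

lemma tform_tmap:
  "tform (tmap (apply_bop A) (apply_bop B) xs) x y =
    tform xs (apply_bop (adj A) x) (apply_bop (adj B) y)"
  by (induction xs) (auto simp: tmap_def cinner_adj_left)

lift_definition amap :: "'h::chilbert_space bop \<Rightarrow> 'k::chilbert_space bop \<Rightarrow>
    ('h, 'k) atensor \<Rightarrow> ('h, 'k) atensor"
  is "\<lambda>A B. tmap (apply_bop A) (apply_bop B)"
  by (simp add: tform_tmap)

lemma amap_apure: "amap A B (apure x y) = apure (apply_bop A x) (apply_bop B y)"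
  by (simp add: apure.abs_eq amap.abs_eq tmap_def)

lemma amap_add: "amap A B (v + w) = amap A B v + amap A B w"
  by (induction v rule: atensor.abs_induct; induction w rule: atensor.abs_induct)
     (simp add: plus_atensor.abs_eq amap.abs_eq tmap_def)

lemma amap_scaleC: "amap A B (scaleC c v) = scaleC c (amap A B v)"
  by (induction v rule: atensor.abs_induct)
     (simp add: scaleC_atensor.abs_eq amap.abs_eq atensor.abs_eq_iff tform_tmap tform_scaleC)

lemma amap_comp: "amap A B v = amap A 1 (amap 1 B v)"
proof (induction v rule: atensor.abs_induct)
  case (1 xs)
  have "tmap (apply_bop A) (apply_bop B) xs =
      tmap (apply_bop A) (apply_bop 1) (tmap (apply_bop 1) (apply_bop B) xs)"
    by (induction xs) (auto simp: tmap_def one_bop.rep_eq)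
  then show ?case by (simp add: amap.abs_eq)
qed

lemma tcoef_tmap:
  "tcoef (tmap (apply_bop A) (apply_bop 1) xs) e = apply_bop A (tcoef xs e)"
proof (induction xs)
  case Nil
  show ?case using apply_bop_scaleC[of A 0 0] by (simp add: tcoef_def tmap_def)
next
  case (Cons p xs)
  then show ?case
    by (cases p) (simp add: tcoef_def tmap_def one_bop.rep_eq apply_bop_add)
qed

lemma tinner_tmap_left_le:
  assumes K: "\<And>x. norm (apply_bop A x) \<le> norm x * K"
  shows "Re (tinner (tmap (apply_bop A) (apply_bop 1) xs) (tmap (apply_bop A) (apply_bop 1) xs))
    \<le> Re (tinner xs xs) * K\<^sup>2"
proof -
  let ?T = "tmap (apply_bop A) (apply_bop 1) :: ('a \<times> 'b) list \<Rightarrow> _"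
  have "finite (snd ` set xs)" by simp
  from orthonormal_expansion[OF this] obtain E where
    E: "\<forall>b\<in>snd ` set xs. b = (\<Sum>e\<in>E. scaleC (cinner e b) e)" by blast
  have "snd ` set (?T xs) = snd ` set xs"
    by (force simp: tmap_def one_bop.rep_eq image_image)
  with E have E': "\<forall>b\<in>snd ` set (?T xs). b = (\<Sum>e\<in>E. scaleC (cinner e b) e)" by simp
  have "Re (tinner (?T xs) (?T xs)) = (\<Sum>e\<in>E. (norm (apply_bop A (tcoef xs e)))\<^sup>2)"
    unfolding tinner_self[OF E'] by (simp add: tcoef_tmap)
  also have "\<dots> \<le> (\<Sum>e\<in>E. (norm (tcoef xs e) * K)\<^sup>2)"
    by (intro sum_mono power_mono K) simp
  also have "\<dots> = Re (tinner xs xs) * K\<^sup>2"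
    unfolding tinner_self[OF E] by (simp add: power_mult_distrib sum_distrib_right)
  finally show ?thesis .
qed

lemma tinner_swap: "tinner (map prod.swap xs) (map prod.swap ys) = tinner xs ys"
  by (simp add: tinner_def comp_def case_prod_unfold mult.commute)

lemma tinner_tmap_right_le:
  assumes K: "\<And>x. norm (apply_bop B x) \<le> norm x * K"
  shows "Re (tinner (tmap (apply_bop 1) (apply_bop B) xs) (tmap (apply_bop 1) (apply_bop B) xs))
    \<le> Re (tinner xs xs) * K\<^sup>2"
proof -
  have eq: "map prod.swap (tmap (apply_bop 1) (apply_bop B) xs) =
      tmap (apply_bop B) (apply_bop 1) (map prod.swap xs)"
    by (induction xs) (auto simp: tmap_def)
  show ?thesis
    using tinner_tmap_left_le[OF K, of "map prod.swap xs"]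
    by (simp only: tinner_swap flip: eq)
qed

lemma norm_amap_le:
  assumes A: "\<And>x. norm (apply_bop A x) \<le> norm x * K" and "K \<ge> 0"
    and B: "\<And>y. norm (apply_bop B y) \<le> norm y * L" and "L \<ge> 0"
  shows "norm (amap A B v) \<le> norm v * (L * K)"
proof -
  have nrm: "(norm (abs_atensor xs))\<^sup>2 = Re (tinner xs xs)" for xs :: "('a \<times> 'b) list"
    by (simp add: power2_norm_eq_inner inner_eq_Re_cinner cinner_atensor.abs_eq)
  have left: "(norm (amap A 1 v))\<^sup>2 \<le> (norm v * K)\<^sup>2" for v :: "('a, 'b) atensor"
    by (induction v rule: atensor.abs_induct)
       (simp add: amap.abs_eq nrm power_mult_distrib tinner_tmap_left_le[OF A])
  have right: "(norm (amap 1 B v))\<^sup>2 \<le> (norm v * L)\<^sup>2" for v :: "('a, 'b) atensor"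
    by (induction v rule: atensor.abs_induct)
       (simp add: amap.abs_eq nrm power_mult_distrib tinner_tmap_right_le[OF B])
  have "norm (amap A B v) \<le> norm (amap 1 B v) * K"
    unfolding amap_comp[of A B] by (rule power2_le_imp_le[OF left]) (simp add: \<open>K \<ge> 0\<close>)
  also have "\<dots> \<le> norm v * L * K"
    by (intro mult_right_mono power2_le_imp_le[OF right]) (simp_all add: \<open>K \<ge> 0\<close> \<open>L \<ge> 0\<close>)
  finally show ?thesis by (simp add: mult.assoc)
qed

definition tensor_op :: "'h::chilbert_space bop \<Rightarrow> 'k::chilbert_space bop \<Rightarrow> ('h, 'k) htensor bop"
    (infixr "\<otimes>\<^sub>o" 70)
  where "A \<otimes>\<^sub>o B = (THE C. \<forall>x y. apply_bop C (x \<otimes>\<^sub>v y) = apply_bop A x \<otimes>\<^sub>v apply_bop B y)"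

lemma tensor_op_ex1:
  fixes A :: "'h::chilbert_space bop" and B :: "'k::chilbert_space bop"
  shows "\<exists>!C. \<forall>x y. apply_bop C (x \<otimes>\<^sub>v y) = apply_bop A x \<otimes>\<^sub>v apply_bop B y"
proof (rule ex_ex1I)
  obtain K where K: "K \<ge> 0" "\<And>x. norm (apply_bop A x) \<le> norm x * K"
    using bounded_linear.nonneg_bounded[OF bounded_linear_apply_bop] by blast
  obtain L where L: "L \<ge> 0" "\<And>x. norm (apply_bop B x) \<le> norm x * L"
    using bounded_linear.nonneg_bounded[OF bounded_linear_apply_bop] by blast
  have "bounded_linear (amap A B)"
    by (rule bounded_linear_intro[where K = "L * K"])
       (simp_all add: amap_add scaleR_scaleC amap_scaleC norm_amap_le K L)
  from bop_extend_completion[OF this amap_scaleC] obtain C where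
    "\<forall>v. apply_bop C (cembed v) = cembed (amap A B v)" by blast
  then show "\<exists>C. \<forall>x y. apply_bop C (x \<otimes>\<^sub>v y) = apply_bop A x \<otimes>\<^sub>v apply_bop B y"
    by (intro exI[of _ C]) (simp add: tensor_vec_def amap_apure)
qed (rule bop_eqI_tensor_vec, simp)

lemma tensor_op_tensor_vec [simp]:
  "apply_bop (A \<otimes>\<^sub>o B) (x \<otimes>\<^sub>v y) = apply_bop A x \<otimes>\<^sub>v apply_bop B y"
  using theI'[OF tensor_op_ex1[of A B]] unfolding tensor_op_def[symmetric] by simp

end

theory Submission
  imports Defs "HOL-Computational_Algebra.Fundamental_Theorem_Algebra"
begin

text \<open>
  For an operator \<open>T\<close> let \<open>\<partial>\<^sub>T X = T* X - X T\<close>. Left multiplication by \<open>T*\<close> commutes with right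
  multiplication by \<open>T\<close>, so by the binomial theorem \<open>\<gamma>\<^sub>n(T*, T) = \<partial>\<^sub>T\<^sup>n(1)\<close>. For
  \<open>A = T1 \<otimes> 1 + 1 \<otimes> T2\<close> the map \<open>\<partial>\<^sub>A\<close> satisfies the product rule
  \<open>\<partial>\<^sub>A(X \<otimes> Y) = \<partial>\<^sub>1 X \<otimes> Y + X \<otimes> \<partial>\<^sub>2 Y\<close>, where \<open>\<partial>\<^sub>1\<close> and \<open>\<partial>\<^sub>2\<close> belong to \<open>T1\<close> and \<open>T2\<close>. Hence,
  with \<open>a\<^sub>k = \<partial>\<^sub>1\<^sup>k(1)\<close> and \<open>b\<^sub>k = \<partial>\<^sub>2\<^sup>k(1)\<close>, the operator \<open>A\<close> is an \<open>n\<close>-symmetry iff the sum of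
  \<open>(n choose k) a\<^sub>k \<otimes> b\<close> with index \<open>n - k\<close> at \<open>b\<close> vanishes (\<open>n_symmetry_tensor_sum_op\<close>).

  Replacing \<open>T1, T2\<close> by \<open>T1 + \<lambda>, T2 - \<lambda>\<close> does not change \<open>A\<close>. So the shifted summands being an \<open>l\<close>- and
  an \<open>m\<close>-symmetry with \<open>l + m = n + 1\<close> forces every term to vanish: it has \<open>k \<ge> l\<close> or \<open>n - k \<ge> m\<close>.

  For the converse, a vanishing sum of elementary tensors stays zero when a linear map is applied
  to all its left (or right) factors. Evaluating the right factors at a matrix coefficient
  \<open>\<langle>y, \<cdot> y\<rangle>\<close> with \<open>y \<noteq> 0\<close> turns the sum into a nontrivial polynomial relation \<open>p(\<partial>\<^sub>1)(1) = 0\<close>, because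
  \<open>b\<^sub>0 = 1\<close>. Over the complex numbers this provides an eigenvector \<open>w = q(\<partial>\<^sub>1)(1)\<close> of \<open>\<partial>\<^sub>1\<close>, for an
  eigenvalue \<open>c\<close> (\<open>eigenvector_in_cyclic_subspace\<close>). Applying \<open>q(\<partial>\<^sub>1)\<close> to the left factors collapses
  the sum to \<open>w \<otimes> (\<partial>\<^sub>2 + c)\<^sup>n(1) = 0\<close>, so \<open>(\<partial>\<^sub>2 + c)\<^sup>n(1) = 0\<close> (\<open>exists_shift_nilpotent_right\<close>).
  Taking adjoints gives \<open>(\<partial>\<^sub>2 - cnj c)\<^sup>n(1) = 0\<close> as well, and a nonzero vector is annihilated by powers of
  at most one shift of a linear map; thus \<open>c\<close> is purely imaginary (\<open>shift_imaginary\<close>), which is exactly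
  the condition for \<open>\<partial>\<^sub>2 + c\<close> to be the map belonging to some \<open>T2 - \<lambda>\<close>, namely for \<open>\<lambda> = c / 2\<close>.

  After this shift \<open>b\<^sub>m = 0\<close> for a least \<open>m\<close>, with \<open>1 \<le> m \<le> n\<close>. Applying powers of \<open>\<partial>\<^sub>2\<close> to
  the right factors isolates one term of the sum after another and kills \<open>a\<^sub>n\<close>, then the
  \<open>a\<close> of the next lower index, down to index \<open>l = n + 1 - m\<close>
  (\<open>n_symmetry_left_from_index_right\<close>).
\<close>

section \<open>Complex-linear maps and their iterates\<close>

lemma vector_space_scaleC: "vector_space (scaleC :: complex \<Rightarrow> 'a::complex_vector \<Rightarrow> 'a)"
  by unfold_locales (simp_all add: scaleC_add_right scaleC_add_left)

abbreviation clinear :: "('a::complex_vector \<Rightarrow> 'b::complex_vector) \<Rightarrow> bool" where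
  "clinear \<equiv> Vector_Spaces.linear scaleC scaleC"

lemma clinearI:
  assumes "\<And>x y. D (x + y) = D x + D y" "\<And>c x. D (scaleC c x) = scaleC c (D x)"
  shows "clinear D"
  using assms by (simp add: Vector_Spaces.linear_iff vector_space_scaleC)

lemma clinear_add: "clinear D \<Longrightarrow> D (x + y) = D x + D y"
  by (simp add: Vector_Spaces.linear_iff)

lemma clinear_scaleC: "clinear D \<Longrightarrow> D (scaleC c x) = scaleC c (D x)"
  by (simp add: Vector_Spaces.linear_iff)

lemma clinear_zero: "clinear D \<Longrightarrow> D 0 = 0"
  using clinear_add[of D 0 0] by simp

lemma clinear_sum: "clinear D \<Longrightarrow> D (\<Sum>i\<in>A. f i) = (\<Sum>i\<in>A. D (f i))"
  by (induction A rule: infinite_finite_induct) (simp_all add: clinear_add clinear_zero)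

lemma clinear_funpow:
  fixes D :: "'a::complex_vector \<Rightarrow> 'a"
  shows "clinear D \<Longrightarrow> clinear (D ^^ n)"
  by (induction n) (auto intro!: clinearI simp: clinear_add clinear_scaleC)

lemma clinear_shift: "clinear D \<Longrightarrow> clinear (\<lambda>x. D x + scaleC a x)"
  by (rule clinearI) (simp_all add: clinear_add clinear_scaleC scaleC_add_right mult.commute)

lemma scaleC_diff_left: "scaleC (a - b) x = scaleC a x - scaleC b (x :: 'a::complex_vector)"
  using scaleC_add_left[of "a - b" b x] by (simp add: eq_diff_eq)

lemma scaleC_eq_0_iff: "scaleC c x = 0 \<longleftrightarrow> c = 0 \<or> x = (0 :: 'a::complex_vector)"
proof -
  interpret vector_space "scaleC :: complex \<Rightarrow> 'a \<Rightarrow> 'a" by (rule vector_space_scaleC)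
  show ?thesis by (rule scale_eq_0_iff)
qed

lemma funpow_eq_0_mono:
  fixes D :: "'a::complex_vector \<Rightarrow> 'a"
  assumes "clinear D" "(D ^^ m) x = 0" "m \<le> k"
  shows "(D ^^ k) x = 0"
proof -
  have "(D ^^ k) x = (D ^^ (k - m)) ((D ^^ m) x)"
    using assms(3) by (metis comp_apply funpow_add le_add_diff_inverse2)
  then show ?thesis using assms by (simp add: clinear_zero clinear_funpow)
qed

lemma funpow_funpow_commute: "(D ^^ i) ((D ^^ k) x) = (D ^^ k) ((D ^^ i) x)"
  by (metis add.commute comp_apply funpow_add)

lemma funpow_first_zero:
  fixes D :: "'a::complex_vector \<Rightarrow> 'a"
  assumes "(D ^^ n) x = 0" "x \<noteq> 0"
  obtains m where "m < n" "(D ^^ m) x \<noteq> 0" "(D ^^ Suc m) x = 0"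
proof -
  define l where "l = (LEAST k. (D ^^ k) x = 0)"
  have l: "(D ^^ l) x = 0" "l \<le> n"
    unfolding l_def using assms(1) by (rule LeastI, rule Least_le)
  then obtain m where m: "l = Suc m" using assms(2) by (cases l) auto
  have "(D ^^ m) x \<noteq> 0" using not_less_Least[of m "\<lambda>k. (D ^^ k) x = 0"] m by (simp add: l_def)
  then show ?thesis using that[of m] l m by simp
qed

lemma funpow_eigenvector:
  assumes "clinear D" "D w = scaleC a w"
  shows "(D ^^ k) w = scaleC (a ^ k) w"
  by (induction k) (simp_all add: assms clinear_scaleC mult.commute)

text \<open>
  The binomial theorem behind all expansions below. A doubly indexed family on which \<open>D\<close> acts by
  raising one index at a time covers a difference of commuting multiplications, a scalar shift of a
  linear map and the product rule on a tensor product alike. The induction is Pascal's rule, for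
  which the starting indices must be arbitrary.
\<close>

lemma funpow_Leibniz:
  assumes D: "clinear D" and F: "\<And>i j. D (F i j) = F (Suc i) j + F i (Suc j)"
  shows "(D ^^ n) (F i j) = (\<Sum>k\<le>n. scaleC (of_nat (n choose k)) (F (i + k) (j + (n - k))))"
proof (induction n arbitrary: i j)
  case (Suc n)
  have "(D ^^ Suc n) (F i j) = (D ^^ n) (F (Suc i) j) + (D ^^ n) (F i (Suc j))"
    by (simp add: funpow_swap1 F clinear_add[OF clinear_funpow[OF D]])
  also have "\<dots> = (\<Sum>k\<le>n. scaleC (of_nat (n choose k)) (F (i + Suc k) (j + (n - k))))
      + (\<Sum>k\<le>n. scaleC (of_nat (n choose k)) (F (i + k) (j + (Suc n - k))))"
    by (simp add: Suc Suc_diff_le)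
  also have "(\<Sum>k\<le>n. scaleC (of_nat (n choose k)) (F (i + k) (j + (Suc n - k))))
      = (\<Sum>k\<le>Suc n. scaleC (of_nat (n choose k)) (F (i + k) (j + (Suc n - k))))"
    by (simp add: binomial_eq_0)
  also have "\<dots> = F i (j + Suc n)
      + (\<Sum>k\<le>n. scaleC (of_nat (n choose Suc k)) (F (i + Suc k) (j + (n - k))))"
    by (subst sum.atMost_Suc_shift) simp
  also have "(\<Sum>k\<le>n. scaleC (of_nat (n choose k)) (F (i + Suc k) (j + (n - k)))) + \<dots>
      = F i (j + Suc n)
      + (\<Sum>k\<le>n. scaleC (of_nat (Suc n choose Suc k)) (F (i + Suc k) (j + (n - k))))"
    by (simp add: scaleC_add_left sum.distrib algebra_simps)
  also have "\<dots> = (\<Sum>k\<le>Suc n. scaleC (of_nat (Suc n choose k)) (F (i + k) (j + (Suc n - k))))"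
    by (subst sum.atMost_Suc_shift) simp
  finally show ?case .
qed simp

lemma funpow_shift:
  assumes D: "clinear D"
  shows "((\<lambda>x. D x + scaleC a x) ^^ n) x
    = (\<Sum>k\<le>n. scaleC (of_nat (n choose k)) (scaleC (a ^ (n - k)) ((D ^^ k) x)))"
  using funpow_Leibniz[OF clinear_shift[OF D], of "\<lambda>i j. scaleC (a ^ j) ((D ^^ i) x)" a n 0 0]
  by (simp add: clinear_scaleC[OF D])

section \<open>Polynomials in a linear map\<close>

definition poly_map :: "complex poly \<Rightarrow> ('a \<Rightarrow> 'a) \<Rightarrow> 'a \<Rightarrow> 'a::complex_vector" where
  "poly_map p D x = (\<Sum>i\<le>degree p. scaleC (coeff p i) ((D ^^ i) x))"

lemma poly_map_eq_sum:
  assumes "degree p \<le> n"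
  shows "poly_map p D x = (\<Sum>i\<le>n. scaleC (coeff p i) ((D ^^ i) x))"
  unfolding poly_map_def
  by (rule sum.mono_neutral_left) (use assms in \<open>auto simp: coeff_eq_0\<close>)

lemma clinear_poly_map: "clinear D \<Longrightarrow> clinear (poly_map p D)"
  by (rule clinearI)
     (simp_all add: poly_map_def clinear_add[OF clinear_funpow] clinear_scaleC[OF clinear_funpow]
       scaleC_add_right sum.distrib scaleC_sum_right mult.commute)

lemma poly_map_funpow: "clinear D \<Longrightarrow> poly_map p D ((D ^^ k) x) = (D ^^ k) (poly_map p D x)"
  by (simp add: poly_map_def clinear_sum[OF clinear_funpow] clinear_scaleC[OF clinear_funpow]
      funpow_funpow_commute[of _ D k])

text \<open>
  This is \<open>(X - a) q\<close> evaluated at \<open>D\<close>; it is the only case of multiplicativity of \<open>p \<mapsto> p(D)\<close> needed to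
  split off one root at a time.
\<close>

lemma poly_map_linear_factor:
  assumes D: "clinear D"
  shows "poly_map ([:- a, 1:] * q) D x = D (poly_map q D x) - scaleC a (poly_map q D x)"
proof -
  let ?n = "degree q"
  have deg: "degree ([:- a, 1:] * q) \<le> Suc ?n"
    using degree_mult_le[of "[:- a, 1:]" q] by simp
  have "poly_map ([:- a, 1:] * q) D x
      = (\<Sum>i\<le>Suc ?n. scaleC (coeff (pCons 0 q) i) ((D ^^ i) x))
        - scaleC a (\<Sum>i\<le>Suc ?n. scaleC (coeff q i) ((D ^^ i) x))"
    unfolding poly_map_eq_sum[OF deg] scaleC_sum_right sum_subtractf[symmetric]
    by (rule sum.cong) (simp_all add: algebra_simps scaleC_add_left flip: scaleC_add_left)
  also have "(\<Sum>i\<le>Suc ?n. scaleC (coeff q i) ((D ^^ i) x)) = poly_map q D x"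
    by (rule poly_map_eq_sum[symmetric]) simp
  also have "(\<Sum>i\<le>Suc ?n. scaleC (coeff (pCons 0 q) i) ((D ^^ i) x)) = D (poly_map q D x)"
    by (subst sum.atMost_Suc_shift) (simp add: poly_map_def clinear_sum[OF D] clinear_scaleC[OF D])
  finally show ?thesis .
qed

text \<open>
  Splitting off the roots of \<open>p\<close> one by one must at some point turn \<open>0 = p(D) v\<close> into a nonzero vector,
  at the latest when the polynomial has become a nonzero constant. The last nonzero vector before
  \<open>0\<close> is an eigenvector for the root removed in that step. It has the form \<open>q(D) v\<close>, which matters
  later: it is the image of \<open>v\<close> under a linear map commuting with \<open>D\<close>.
\<close>

lemma eigenvector_in_cyclic_subspace:
  assumes D: "clinear D" and "v \<noteq> 0" "p \<noteq> 0" "poly_map p D v = 0"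
  shows "\<exists>q a. poly_map q D v \<noteq> 0 \<and> D (poly_map q D v) = scaleC a (poly_map q D v)"
  using assms(3,4)
proof (induction "degree p" arbitrary: p rule: less_induct)
  case less
  have "degree p \<noteq> 0"
  proof
    assume "degree p = 0"
    then obtain c where "p = [:c:]" by (rule degree_eq_zeroE)
    then show False using less.prems \<open>v \<noteq> 0\<close> by (simp add: poly_map_def scaleC_eq_0_iff)
  qed
  then obtain a where "poly p a = 0"
    using fundamental_theorem_of_algebra[of p] by (auto simp: constant_degree)
  then obtain q where q: "p = [:- a, 1:] * q" by (auto simp: poly_eq_0_iff_dvd)
  have "q \<noteq> 0" using less.prems(1) q by auto
  then have deg: "degree q < degree p" unfolding q by (subst degree_mult_eq) auto
  show ?case
  proof (cases "poly_map q D v = 0")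
    case True
    then show ?thesis using less.hyps[OF deg \<open>q \<noteq> 0\<close>] by blast
  next
    case False
    then show ?thesis using less.prems(2) poly_map_linear_factor[OF D, of a q v]
      unfolding q by (intro exI[of _ q] exI[of _ a]) simp
  qed
qed

text \<open>
  Let \<open>u\<close> be the last nonzero iterate of \<open>x\<close> under \<open>D + a\<close>. Then \<open>D u = - a u\<close>, so \<open>(D + b)\<^sup>m\<close> multiplies \<open>u\<close>
  by \<open>(b - a)\<^sup>m\<close>; but it also kills \<open>u\<close>, because it commutes with \<open>D + a\<close> and kills \<open>x\<close>.
\<close>

lemma generalized_eigenvalue_unique:
  assumes D: "clinear D" and "x \<noteq> 0"
    and a: "((\<lambda>x. D x + scaleC a x) ^^ n) x = 0" and b: "((\<lambda>x. D x + scaleC b x) ^^ m) x = 0"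
  shows "a = b"
proof -
  let ?A = "\<lambda>x. D x + scaleC a x" and ?B = "\<lambda>x. D x + scaleC b x"
  have A: "clinear ?A" and B: "clinear ?B" using D by (rule clinear_shift)+
  obtain l where l: "(?A ^^ l) x \<noteq> 0" "(?A ^^ Suc l) x = 0"
    using a \<open>x \<noteq> 0\<close> by (rule funpow_first_zero)
  define u where "u = (?A ^^ l) x"
  have "?A u = 0" using l(2) by (simp add: u_def)
  then have "D u = scaleC (- a) u" by (simp add: scaleC_minus_left eq_neg_iff_add_eq_0)
  then have "?B u = scaleC (b - a) u"
    by (simp flip: scaleC_add_left)
  then have "(?B ^^ m) u = scaleC ((b - a) ^ m) u"
    by (rule funpow_eigenvector[OF B])
  moreover have "(?B ^^ m) u = (?A ^^ l) ((?B ^^ m) x)"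
  proof -
    have "?B (?A y) = ?A (?B y)" for y
      by (simp add: clinear_add[OF D] clinear_scaleC[OF D] scaleC_add_right mult.commute)
    then have "?B ((?A ^^ l) y) = (?A ^^ l) (?B y)" for y
      by (induction l) simp_all
    then show ?thesis unfolding u_def by (induction m) simp_all
  qed
  ultimately have "scaleC ((b - a) ^ m) u = 0"
    by (simp add: b clinear_zero[OF clinear_funpow[OF A]])
  then show ?thesis using l(1) by (simp add: scaleC_eq_0_iff u_def)
qed

section \<open>Adjoints and the symmetry defect\<close>

lemma adj_eqI:
  assumes "\<And>x y. cinner (apply_bop S x) y = cinner x (apply_bop T y)"
  shows "adj T = S"
  by (rule bop_eqI, rule cinner_ext_left) (simp add: cinner_adj_left assms)

lemma cinner_adj_right: "cinner x (apply_bop (adj T) y) = cinner (apply_bop T x) y"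
  by (metis cinner_adj_left cinner_commute)

lemma adj_adj [simp]: "adj (adj T) = T"
  by (rule adj_eqI) (simp add: cinner_adj_right)

lemma adj_zero [simp]: "adj 0 = 0"
  by (rule adj_eqI) (simp add: zero_bop.rep_eq)

lemma adj_one [simp]: "adj 1 = 1"
  by (rule adj_eqI) (simp add: one_bop.rep_eq)

lemma adj_add: "adj (S + T) = adj S + adj T"
  by (rule adj_eqI)
     (simp add: plus_bop.rep_eq cinner_add_left cinner_add_right cinner_adj_left)

lemma adj_uminus: "adj (- T) = - adj T"
  by (rule adj_eqI) (simp add: uminus_bop.rep_eq cinner_adj_left)

lemma adj_diff: "adj (S - T) = adj S - adj T"
  by (simp only: diff_conv_add_uminus adj_add adj_uminus)

lemma adj_scaleC: "adj (scaleC c T) = scaleC (cnj c) (adj T)"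
  by (rule adj_eqI) (simp add: scaleC_bop.rep_eq cinner_adj_left)

lemma adj_mult: "adj (S * T) = adj T * adj S"
  by (rule adj_eqI) (simp add: times_bop.rep_eq cinner_adj_left)

lemma bop_eqI_cinner:
  assumes "\<And>x y. cinner x (apply_bop S y) = cinner x (apply_bop T y)"
  shows "S = T"
  by (rule bop_eqI, rule cinner_ext) (rule assms)

lemma apply_bop_sum: "apply_bop (\<Sum>i\<in>I. f i) x = (\<Sum>i\<in>I. apply_bop (f i) x)"
  by (induction I rule: infinite_finite_induct) (simp_all add: zero_bop.rep_eq plus_bop.rep_eq)

definition der :: "'a::chilbert_space bop \<Rightarrow> 'a bop \<Rightarrow> 'a bop" where
  "der T X = adj T * X - X * T"

lemma clinear_der: "clinear (der T)"
  by (rule clinearI) (simp_all add: der_def algebra_simps scaleC_diff_right)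

lemma adj_der: "adj (der T X) = - der T (adj X)"
  by (simp add: der_def adj_diff adj_mult)

text \<open>
  A scalar shift of \<open>T\<close> shifts \<open>der T\<close> by a purely imaginary number, and every purely imaginary
  number arises in this way.
\<close>

lemma der_shift: "der (T + scaleC c 1) X = der T X + scaleC (cnj c - c) X"
  by (simp add: der_def adj_add adj_scaleC distrib_left distrib_right scaleC_diff_left)

text \<open>
  Right multiplication by \<open>- T\<close> commutes with left multiplication by \<open>S\<close>, so this is the binomial
  expansion.
\<close>

lemma gamma_n_eq_funpow: "gamma_n n S T = ((\<lambda>X. S * X - X * T) ^^ n) 1"
proof -
  have lin: "clinear (\<lambda>X. S * X - X * T)"
    by (rule clinearI) (simp_all add: algebra_simps scaleC_diff_right)
  have "((\<lambda>X. S * X - X * T) ^^ n) 1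
      = (\<Sum>k\<le>n. scaleC (of_nat (n choose k)) (scaleC ((- 1) ^ (n - k)) (S ^ k * T ^ (n - k))))"
    using funpow_Leibniz[OF lin, of "\<lambda>i j. scaleC ((- 1) ^ j) (S ^ i * T ^ j)" n 0 0]
    by (simp add: scaleC_minus_left mult.assoc power_commutes)
  then show ?thesis by (simp add: gamma_n_def atMost_atLeast0 mult.commute)
qed

lemma n_symmetry_iff_der: "n_symmetry n T \<longleftrightarrow> (der T ^^ n) 1 = 0"
  by (simp add: n_symmetry_def gamma_n_eq_funpow der_def[abs_def])

lemma bop_one_neq_zero:
  assumes "\<exists>x :: 'a::complex_inner. x \<noteq> 0"
  shows "(1 :: 'a bop) \<noteq> 0"
  using assms by (metis one_bop.rep_eq zero_bop.rep_eq)

lemma adj_funpow_shift_der: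
  "adj (((\<lambda>X. der T X + scaleC a X) ^^ n) X)
    = scaleC ((- 1) ^ n) (((\<lambda>X. der T X + scaleC (- cnj a) X) ^^ n) (adj X))"
proof (induction n)
  case (Suc n)
  let ?E = "\<lambda>X. der T X + scaleC a X" and ?E' = "\<lambda>X. der T X + scaleC (- cnj a) X"
  have lin: "clinear ?E'"
    by (rule clinear_shift[OF clinear_der])
  have step: "adj (?E Y) = - ?E' (adj Y)" for Y
    by (simp add: adj_add adj_der adj_scaleC scaleC_minus_left)
  have "adj ((?E ^^ Suc n) X) = - ?E' (scaleC ((- 1) ^ n) ((?E' ^^ n) (adj X)))"
    by (simp only: funpow.simps comp_apply step Suc)
  also have "\<dots> = - scaleC ((- 1) ^ n) ((?E' ^^ Suc n) (adj X))"
    by (simp only: funpow.simps comp_apply clinear_scaleC[OF lin])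
  finally show ?case by (simp only: power_Suc mult_minus_left mult_1 scaleC_minus_left)
qed simp

text \<open>
  By \<open>adj_funpow_shift_der\<close> the hypothesis for \<open>a\<close> implies the one for \<open>- cnj a\<close>, and the shift is unique.
\<close>

lemma shift_imaginary:
  assumes "\<exists>x :: 'a::chilbert_space. x \<noteq> 0"
    and "((\<lambda>X. der (T :: 'a bop) X + scaleC a X) ^^ n) 1 = 0"
  shows "cnj a = - a"
proof -
  have "scaleC ((- 1) ^ n) (((\<lambda>X. der T X + scaleC (- cnj a) X) ^^ n) (1 :: 'a bop)) = 0"
    using adj_funpow_shift_der[where T = T and a = a and n = n and X = 1] assms(2) by simp
  then have "((\<lambda>X. der T X + scaleC (- cnj a) X) ^^ n) (1 :: 'a bop) = 0"
    by (simp add: scaleC_eq_0_iff)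
  then have "a = - cnj a"
    using generalized_eigenvalue_unique[OF clinear_der bop_one_neq_zero[OF assms(1)] assms(2)] by blast
  then show ?thesis by (metis minus_minus)
qed

section \<open>Operators on the tensor product\<close>

lemma tensor_vec_add_left: "(x + x') \<otimes>\<^sub>v y = x \<otimes>\<^sub>v y + x' \<otimes>\<^sub>v y"
  and tensor_vec_add_right: "x \<otimes>\<^sub>v (y + y') = x \<otimes>\<^sub>v y + x \<otimes>\<^sub>v y'"
  and tensor_vec_scaleC_left: "scaleC c x \<otimes>\<^sub>v y = scaleC c (x \<otimes>\<^sub>v y)"
  and tensor_vec_scaleC_right: "x \<otimes>\<^sub>v scaleC c y = scaleC c (x \<otimes>\<^sub>v y)"
  by (simp_all add: tensor_vec_def apure_add_left apure_add_right apure_scaleC_left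
      apure_scaleC_right cembed_add cembed_scaleC)

lemma tensor_op_add_left: "(A + A') \<otimes>\<^sub>o B = A \<otimes>\<^sub>o B + A' \<otimes>\<^sub>o B"
  and tensor_op_add_right: "A \<otimes>\<^sub>o (B + B') = A \<otimes>\<^sub>o B + A \<otimes>\<^sub>o B'"
  and tensor_op_scaleC_left: "scaleC c A \<otimes>\<^sub>o B = scaleC c (A \<otimes>\<^sub>o B)"
  and tensor_op_scaleC_right: "A \<otimes>\<^sub>o scaleC c B = scaleC c (A \<otimes>\<^sub>o B)"
  and tensor_op_one: "1 \<otimes>\<^sub>o 1 = 1"
  and tensor_op_mult: "(A \<otimes>\<^sub>o B) * (C \<otimes>\<^sub>o D) = (A * C) \<otimes>\<^sub>o (B * D)"
  by (rule bop_eqI_tensor_vec;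
      simp add: plus_bop.rep_eq scaleC_bop.rep_eq one_bop.rep_eq times_bop.rep_eq
        tensor_vec_add_left tensor_vec_add_right tensor_vec_scaleC_left tensor_vec_scaleC_right)+

lemma clinear_tensor_op_left: "clinear (\<lambda>A. A \<otimes>\<^sub>o B)"
  and clinear_tensor_op_right: "clinear (\<lambda>B. A \<otimes>\<^sub>o B)"
  by (rule clinearI; simp add: tensor_op_add_left tensor_op_add_right tensor_op_scaleC_left
      tensor_op_scaleC_right)+

lemma tensor_op_diff_left: "(A - A') \<otimes>\<^sub>o B = A \<otimes>\<^sub>o B - A' \<otimes>\<^sub>o B"
  and tensor_op_diff_right: "A \<otimes>\<^sub>o (B - B') = A \<otimes>\<^sub>o B - A \<otimes>\<^sub>o B'"
  using tensor_op_add_left[of "A - A'" A' B] tensor_op_add_right[of A "B - B'" B']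
  by (simp_all add: eq_diff_eq)

text \<open>
  Finite sums of elementary tensors are dense in the completed tensor product, so elementary
  tensors separate its points.
\<close>

lemma cinner_ext_tensor_vec:
  fixes u v :: "('h::complex_inner, 'k::complex_inner) htensor"
  assumes "\<And>x y. cinner (x \<otimes>\<^sub>v y) u = cinner (x \<otimes>\<^sub>v y) v"
  shows "u = v"
proof (rule cinner_ext)
  fix z :: "('h, 'k) htensor"
  have eq: "cinner (cembed t) u = cinner (cembed t) v" for t :: "('h, 'k) atensor"
    by (induction t rule: atensor_induct)
       (simp_all add: cembed_add cinner_add_left assms flip: tensor_vec_def)
  obtain X where X: "Cauchy X" "z = abs_completion X" by (rule completion_cases)
  have "(\<lambda>n. cinner (cembed (X n)) u) \<longlonglongrightarrow> cinner z u"
    unfolding X(2) by (intro tendsto_cinner cembed_tendsto X tendsto_const)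
  moreover have "(\<lambda>n. cinner (cembed (X n)) u) \<longlonglongrightarrow> cinner z v"
    unfolding X(2) eq by (intro tendsto_cinner cembed_tendsto X tendsto_const)
  ultimately show "cinner z u = cinner z v" by (rule LIMSEQ_unique)
qed

lemma adj_tensor_op: "adj (A \<otimes>\<^sub>o B) = adj A \<otimes>\<^sub>o adj B"
  by (rule bop_eqI_tensor_vec, rule cinner_ext_tensor_vec)
     (simp add: cinner_adj_right cinner_tensor_vec)

text \<open>
  Matrix coefficients at elementary tensors detect zero. Unlike the left-hand side, the scalar
  condition is visibly symmetric in the two factors, and fixing the vectors of one factor leaves an
  identity between operators on the other one.
\<close>

lemma tensor_sum_eq_0_iff:
  "(\<Sum>i\<in>I. A i \<otimes>\<^sub>o B i) = 0 \<longleftrightarrow>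
    (\<forall>x x' y y'. (\<Sum>i\<in>I. cinner x (apply_bop (A i) x') * cinner y (apply_bop (B i) y')) = 0)"
    (is "?S = 0 \<longleftrightarrow> ?R")
proof -
  have coef: "cinner (x \<otimes>\<^sub>v y) (apply_bop ?S (x' \<otimes>\<^sub>v y'))
      = (\<Sum>i\<in>I. cinner x (apply_bop (A i) x') * cinner y (apply_bop (B i) y'))" for x x' y y'
    by (simp add: apply_bop_sum cinner_sum_right cinner_tensor_vec)
  show ?thesis
  proof
    assume "?S = 0"
    then show ?R using coef by (simp add: zero_bop.rep_eq)
  next
    assume R: ?R
    show "?S = 0"
      by (rule bop_eqI_tensor_vec, rule cinner_ext_tensor_vec)
         (simp only: coef R zero_bop.rep_eq cinner_zero_right)
  qed
qed

lemma tensor_sum_slice_left: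
  assumes "(\<Sum>i\<in>I. A i \<otimes>\<^sub>o B i) = 0"
  shows "(\<Sum>i\<in>I. scaleC (cinner y (apply_bop (B i) y')) (A i)) = 0"
  by (rule bop_eqI_cinner)
     (use assms in \<open>simp add: tensor_sum_eq_0_iff apply_bop_sum cinner_sum_right scaleC_bop.rep_eq
        zero_bop.rep_eq mult.commute\<close>)

lemma tensor_sum_slice_right:
  assumes "(\<Sum>i\<in>I. A i \<otimes>\<^sub>o B i) = 0"
  shows "(\<Sum>i\<in>I. scaleC (cinner x (apply_bop (A i) x')) (B i)) = 0"
  by (rule bop_eqI_cinner)
     (use assms in \<open>simp add: tensor_sum_eq_0_iff apply_bop_sum cinner_sum_right scaleC_bop.rep_eq
        zero_bop.rep_eq\<close>)

text \<open>
  \<open>F\<close> is any linear map on operators, possibly discontinuous, so there is no evident induced map on the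
  operators of the completed tensor product. Fixing the vectors \<open>y\<close> and \<open>y'\<close> leaves a linear relation
  between the operators \<open>A i\<close>, which \<open>F\<close> preserves.
\<close>

lemma tensor_sum_map_left:
  assumes F: "clinear F" and "(\<Sum>i\<in>I. A i \<otimes>\<^sub>o B i) = 0"
  shows "(\<Sum>i\<in>I. F (A i) \<otimes>\<^sub>o B i) = 0"
  unfolding tensor_sum_eq_0_iff
proof (intro allI)
  fix x x' y y'
  have "F (\<Sum>i\<in>I. scaleC (cinner y (apply_bop (B i) y')) (A i)) = 0"
    by (simp add: tensor_sum_slice_left[OF assms(2)] clinear_zero[OF F])
  then have "(\<Sum>i\<in>I. scaleC (cinner y (apply_bop (B i) y')) (F (A i))) = 0"
    by (simp add: clinear_sum[OF F] clinear_scaleC[OF F])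
  from arg_cong[OF this, of "\<lambda>S. cinner x (apply_bop S x')"]
  show "(\<Sum>i\<in>I. cinner x (apply_bop (F (A i)) x') * cinner y (apply_bop (B i) y')) = 0"
    by (simp add: apply_bop_sum cinner_sum_right scaleC_bop.rep_eq zero_bop.rep_eq mult.commute)
qed

lemma tensor_sum_map_right:
  assumes F: "clinear F" and "(\<Sum>i\<in>I. A i \<otimes>\<^sub>o B i) = 0"
  shows "(\<Sum>i\<in>I. A i \<otimes>\<^sub>o F (B i)) = 0"
  unfolding tensor_sum_eq_0_iff
proof (intro allI)
  fix x x' y y'
  have "F (\<Sum>i\<in>I. scaleC (cinner x (apply_bop (A i) x')) (B i)) = 0"
    by (simp add: tensor_sum_slice_right[OF assms(2)] clinear_zero[OF F])
  then have "(\<Sum>i\<in>I. scaleC (cinner x (apply_bop (A i) x')) (F (B i))) = 0"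
    by (simp add: clinear_sum[OF F] clinear_scaleC[OF F])
  from arg_cong[OF this, of "\<lambda>S. cinner y (apply_bop S y')"]
  show "(\<Sum>i\<in>I. cinner x (apply_bop (A i) x') * cinner y (apply_bop (F (B i)) y')) = 0"
    by (simp add: apply_bop_sum cinner_sum_right scaleC_bop.rep_eq zero_bop.rep_eq)
qed

lemma tensor_op_eq_0_iff: "A \<otimes>\<^sub>o B = 0 \<longleftrightarrow> A = 0 \<or> B = 0"
proof
  assume "A \<otimes>\<^sub>o B = 0"
  then have coef: "cinner x (apply_bop A x') * cinner y (apply_bop B y') = 0" for x x' y y'
    using tensor_sum_eq_0_iff[where I = "{()}" and A = "\<lambda>_. A" and B = "\<lambda>_. B"] by auto
  show "A = 0 \<or> B = 0"
  proof (rule disjCI)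
    assume "B \<noteq> 0"
    then obtain y y' where "cinner y (apply_bop B y') \<noteq> 0"
      using bop_eqI_cinner[of B 0] by (auto simp: zero_bop.rep_eq)
    with coef have "cinner x (apply_bop A x') = 0" for x x' by auto
    then show "A = 0" by (intro bop_eqI_cinner) (simp add: zero_bop.rep_eq)
  qed
qed (auto simp: clinear_zero[OF clinear_tensor_op_left] clinear_zero[OF clinear_tensor_op_right])

definition tensor_sum_op :: "'h::chilbert_space bop \<Rightarrow> 'k::chilbert_space bop \<Rightarrow> ('h, 'k) htensor bop"
  where "tensor_sum_op T1 T2 = T1 \<otimes>\<^sub>o 1 + 1 \<otimes>\<^sub>o T2"

lemma tensor_sum_op_shift:
  "tensor_sum_op (T1 + scaleC c 1) (T2 - scaleC c 1) = tensor_sum_op T1 T2"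
  by (simp add: tensor_sum_op_def tensor_op_add_left tensor_op_diff_right tensor_op_scaleC_left
      tensor_op_scaleC_right)

lemma der_tensor_sum_op:
  "der (tensor_sum_op T1 T2) (X \<otimes>\<^sub>o Y) = der T1 X \<otimes>\<^sub>o Y + X \<otimes>\<^sub>o der T2 Y"
  by (simp add: der_def tensor_sum_op_def adj_add adj_tensor_op tensor_op_mult tensor_op_diff_left
      tensor_op_diff_right algebra_simps)

lemma n_symmetry_tensor_sum_op:
  "n_symmetry n (tensor_sum_op T1 T2) \<longleftrightarrow>
    (\<Sum>k\<le>n. scaleC (of_nat (n choose k)) ((der T1 ^^ k) 1) \<otimes>\<^sub>o (der T2 ^^ (n - k)) 1) = 0"
  using funpow_Leibniz[OF clinear_der, of "tensor_sum_op T1 T2"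
      "\<lambda>i j. (der T1 ^^ i) 1 \<otimes>\<^sub>o (der T2 ^^ j) 1" n 0 0]
  by (simp add: n_symmetry_iff_der der_tensor_sum_op tensor_op_one tensor_op_scaleC_left)

section \<open>Tensor sums and the orders of their summands\<close>

lemma n_symmetry_tensor_sum_opI:
  assumes l: "n_symmetry l T1" and m: "n_symmetry m T2" and "l + m \<le> n + 1"
  shows "n_symmetry n (tensor_sum_op T1 T2)"
  unfolding n_symmetry_tensor_sum_op
proof (rule sum.neutral, rule ballI)
  fix k
  have "l \<le> k \<or> m \<le> n - k" using assms(3) by linarith
  then have "(der T1 ^^ k) 1 = 0 \<or> (der T2 ^^ (n - k)) 1 = 0"
    using l m by (metis n_symmetry_iff_der funpow_eq_0_mono clinear_der)
  then show "scaleC (of_nat (n choose k)) ((der T1 ^^ k) 1) \<otimes>\<^sub>o (der T2 ^^ (n - k)) 1 = 0"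
    by (auto simp: tensor_op_eq_0_iff)
qed

text \<open>
  The number \<open>a\<close> is an eigenvalue of \<open>der T1\<close>, with an eigenvector \<open>w\<close> in the span of the operators
  \<open>(der T1 ^^ k) 1\<close>. Mapping \<open>1\<close> to \<open>w\<close> by a polynomial in \<open>der T1\<close> turns these operators into the multiples
  \<open>a ^ k\<close> of \<open>w\<close>, and the expansion of \<open>n_symmetry n (tensor_sum_op T1 T2)\<close> becomes \<open>w\<close> tensored with a
  binomial sum.
\<close>

lemma exists_shift_nilpotent_right:
  fixes T1 :: "'h::chilbert_space bop" and T2 :: "'k::chilbert_space bop"
  assumes H: "\<exists>x :: 'h. x \<noteq> 0" and K: "\<exists>y :: 'k. y \<noteq> 0"
    and n: "n_symmetry n (tensor_sum_op T1 T2)"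
  shows "\<exists>a. ((\<lambda>X. der T2 X + scaleC a X) ^^ n) 1 = 0"
proof -
  note lin = clinear_der[of T1]
  note sum0 = n[unfolded n_symmetry_tensor_sum_op]
  obtain y :: 'k where y: "y \<noteq> 0" using K by blast
  (* The coefficients of a slice of the vanishing sum. The one of index n is nonzero, as b_0 = 1. *)
  define c where "c k = of_nat (n choose k) * cinner y (apply_bop ((der T2 ^^ (n - k)) 1) y)" for k
  define p where "p = (\<Sum>k\<le>n. monom (c k) k)"
  have coeff_p: "coeff p k = (if k \<le> n then c k else 0)" for k
    by (simp add: p_def coeff_sum)
  have "c n \<noteq> 0" using y by (simp add: c_def one_bop.rep_eq)
  then have "p \<noteq> 0" using coeff_p[of n] by auto
  have "degree p \<le> n" by (rule degree_le) (simp add: coeff_p)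
  then have "poly_map p (der T1) 1 = (\<Sum>k\<le>n. scaleC (c k) ((der T1 ^^ k) 1))"
    by (simp add: poly_map_eq_sum coeff_p)
  also have "\<dots> = 0"
    using tensor_sum_slice_left[OF sum0, of y y] by (simp add: c_def mult.commute)
  finally obtain q a where w: "poly_map q (der T1) 1 \<noteq> 0"
      "der T1 (poly_map q (der T1) 1) = scaleC a (poly_map q (der T1) 1)"
    using eigenvector_in_cyclic_subspace[OF lin bop_one_neq_zero[OF H] \<open>p \<noteq> 0\<close>] by blast
  define w where "w = poly_map q (der T1) 1"
  have "poly_map q (der T1) ((der T1 ^^ k) 1) = scaleC (a ^ k) w" for k
    using funpow_eigenvector[OF lin w(2)] by (simp add: poly_map_funpow[OF lin] w_def)
  then have "0 = (\<Sum>k\<le>n. scaleC (of_nat (n choose k)) (scaleC (a ^ k) w) \<otimes>\<^sub>o (der T2 ^^ (n - k)) 1)"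
    using tensor_sum_map_left[OF clinear_poly_map[OF lin, of q] sum0]
    by (simp add: clinear_scaleC[OF clinear_poly_map[OF lin]])
  also have "\<dots> = (\<Sum>k\<le>n. w \<otimes>\<^sub>o scaleC (of_nat (n choose k)) (scaleC (a ^ k) ((der T2 ^^ (n - k)) 1)))"
    by (simp add: tensor_op_scaleC_left tensor_op_scaleC_right)
  also have "\<dots> = w \<otimes>\<^sub>o (\<Sum>k\<le>n. scaleC (of_nat (n choose k)) (scaleC (a ^ k) ((der T2 ^^ (n - k)) 1)))"
    by (simp add: clinear_sum[OF clinear_tensor_op_right])
  also have "(\<Sum>k\<le>n. scaleC (of_nat (n choose k)) (scaleC (a ^ k) ((der T2 ^^ (n - k)) 1)))
      = ((\<lambda>X. der T2 X + scaleC a X) ^^ n) 1"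
    unfolding funpow_shift[OF clinear_der]
    (* the eigenvalue carries the exponent k and the operator n - k, so the sum is reversed *)
    by (subst sum.nat_diff_reindex[symmetric, of _ "Suc n", unfolded lessThan_Suc_atMost])
       (auto intro!: sum.cong simp flip: binomial_symmetric)
  finally show ?thesis using w(1) by (auto simp: tensor_op_eq_0_iff w_def)
qed

text \<open>
  Downward induction on the exponent \<open>n - s\<close>. Applying \<open>der T2 ^^ (r - s)\<close> to the right factors of the
  expansion annihilates the terms with \<open>k < n - s\<close>, since their right exponent then exceeds \<open>r\<close>. The
  terms with \<open>k > n - s\<close> vanish by the induction hypothesis. In the remaining one the right factor
  is \<open>(der T2 ^^ r) 1\<close>, which is nonzero, so the left factor is zero.
\<close>

lemma n_symmetry_left_from_index_right:
  fixes T1 :: "'h::chilbert_space bop" and T2 :: "'k::chilbert_space bop"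
  assumes n: "n_symmetry n (tensor_sum_op T1 T2)"
    and r: "(der T2 ^^ r) 1 \<noteq> 0" "(der T2 ^^ Suc r) 1 = 0" and "r \<le> n"
  shows "n_symmetry (n - r) T1"
proof -
  have "s \<le> r \<Longrightarrow> (der T1 ^^ (n - s)) 1 = 0" for s
  proof (induction s rule: less_induct)
    case (less s)
    have s: "n - s \<le> n" "n - (n - s) = s" using less.prems \<open>r \<le> n\<close> by auto
    define f where "f k = scaleC (of_nat (n choose k)) ((der T1 ^^ k) 1)
      \<otimes>\<^sub>o (der T2 ^^ (r - s)) ((der T2 ^^ (n - k)) 1)" for k
    have "0 = (\<Sum>k\<le>n. f k)"
      using tensor_sum_map_right[OF clinear_funpow[OF clinear_der, of "r - s" T2]
          n[unfolded n_symmetry_tensor_sum_op]] by (simp add: f_def)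
    also have "\<dots> = (\<Sum>k\<in>{n - s}. f k)"
    proof (rule sum.mono_neutral_right, simp, simp, rule ballI)
      fix k assume k: "k \<in> {..n} - {n - s}"
      show "f k = 0"
      proof (cases "k < n - s")
        case True
        then have "Suc r \<le> r - s + (n - k)" by linarith
        then have "(der T2 ^^ (r - s + (n - k))) 1 = 0"
          by (rule funpow_eq_0_mono[OF clinear_der r(2)])
        then show ?thesis by (simp add: f_def tensor_op_eq_0_iff funpow_add)
      next
        case False
        with k have "n - k < s" "n - (n - k) = k" by auto
        then have "(der T1 ^^ k) 1 = 0" using less.IH[of "n - k"] less.prems by simp
        then show ?thesis by (simp add: f_def tensor_op_eq_0_iff)
      qed
    qed
    also have "\<dots> = scaleC (of_nat (n choose (n - s))) ((der T1 ^^ (n - s)) 1) \<otimes>\<^sub>o (der T2 ^^ r) 1"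
      using less.prems by (simp add: f_def s flip: funpow_add comp_apply[of "_ ^^ _"])
    finally show ?case
      using r(1) s(1) by (simp add: tensor_op_eq_0_iff scaleC_eq_0_iff)
  qed
  then show ?thesis by (simp add: n_symmetry_iff_der)
qed

theorem theorem1p3:
  fixes T1 :: "'h::chilbert_space bop" and T2 :: "'k::chilbert_space bop" and n :: nat
  assumes "\<exists>x :: 'h. x \<noteq> 0" and "\<exists>y :: 'k. y \<noteq> 0" and "n > 0"
  shows "n_symmetry n (T1 \<otimes>\<^sub>o (1 :: 'k bop) + (1 :: 'h bop) \<otimes>\<^sub>o T2) \<longleftrightarrow>
    (\<exists>l m :: nat. \<exists>lam :: complex. l > 0 \<and> m > 0 \<and> l + m = n + 1 \<and>
      n_symmetry l (T1 + scaleC lam 1) \<and> n_symmetry m (T2 - scaleC lam 1))"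
    (is "?a \<longleftrightarrow> ?b")
proof
  assume ?a
  then have a: "n_symmetry n (tensor_sum_op T1 T2)" by (simp add: tensor_sum_op_def)
  obtain c where c: "((\<lambda>X. der T2 X + scaleC c X) ^^ n) 1 = 0"
    using exists_shift_nilpotent_right[OF assms(1,2) a] by blast
  have "cnj c = - c" by (rule shift_imaginary[OF assms(2) c])
  (* For imaginary c this solves lam - cnj lam = c, the shift of der caused by subtracting lam. *)
  define lam where "lam = c / 2"
  let ?S1 = "T1 + scaleC lam 1" and ?S2 = "T2 - scaleC lam 1"
  have S2: "?S2 = T2 + scaleC (- lam) 1" by (simp add: scaleC_minus_left)
  have "der ?S2 = (\<lambda>X. der T2 X + scaleC c X)"
    by (rule ext) (simp only: S2 der_shift, simp add: lam_def \<open>cnj c = - c\<close>)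
  then have "(der ?S2 ^^ n) 1 = 0" using c by simp
  then obtain r where r: "r < n" "(der ?S2 ^^ r) 1 \<noteq> 0" "(der ?S2 ^^ Suc r) 1 = 0"
    by (rule funpow_first_zero[OF _ bop_one_neq_zero[OF assms(2)]])
  have "n_symmetry n (tensor_sum_op ?S1 ?S2)"
    by (simp only: tensor_sum_op_shift a)
  then have "n_symmetry (n - r) ?S1"
    by (rule n_symmetry_left_from_index_right[OF _ r(2,3) less_imp_le[OF r(1)]])
  moreover have "n_symmetry (Suc r) ?S2" using r(3) by (simp only: n_symmetry_iff_der)
  ultimately show ?b
    using r(1) by (intro exI[of _ "n - r"] exI[of _ "Suc r"] exI[of _ lam]) simp
next
  assume ?b
  then obtain l m lam where "l + m = n + 1" "n_symmetry l (T1 + scaleC lam 1)"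
      "n_symmetry m (T2 - scaleC lam 1)" by blast
  then have "n_symmetry n (tensor_sum_op (T1 + scaleC lam 1) (T2 - scaleC lam 1))"
    by (intro n_symmetry_tensor_sum_opI[of l _ m]) simp_all
  then show ?a by (simp only: tensor_sum_op_shift) (simp add: tensor_sum_op_def)
qed

end
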